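(* Let $p$ be an odd prime, $m\ge3$ odd, $k\ge1$ even with $\gcd(m,k)=1$, and $\lambda$ a fixed nonsquare in $\mathbb{F}_p$. As $(a,b,c)$ runs through $\mathbb{F}_{p^m}^3$, the values of $S(a,b,c)$ and their frequencies are: - $2(p-1)p^m$: $1$; - $(p-1)p^m$: $2(p^m-1)$; - $(p-1)p^{\frac{m+1}{2}}$: $(p^m-1)(p^m-p^{m-1})(p^{m-1}+p^{\frac{m-1}{2}})$; - $-(p-1)p^{\frac{m+1}{2}}$: $(p^m-1)(p^m-p^{m-1})(p^{m-1}-p^{\frac{m-1}{2}})$; - $2(p-1)p^{\frac{m+1}{2}}$: $\frac14(p^m-1)(p^{m-1}+p^{\frac{m-1}{2}})^2$; - $-2(p-1)p^{\frac{m+1}{2}}$: $\frac14(p^m-1)(p^{m-1}-p^{\frac{m-1}{2}})^2$; - $0$: $(p^m-1)\big(p^{2m}+\frac32p^{2(m-1)}-2p^{2m-1}+p^m-\frac12p^{m-1}-1\big)$.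
   Context: $\mathrm{Tr}$ is the trace from $\mathbb{F}_{p^m}$ to $\mathbb{F}_p$ and $\zeta_p=e^{2\pi i/p}$. $S(a,b,c)=\sum_{y\in\mathbb{F}_p^*}\sum_{x\in\mathbb{F}_{p^m}}\big(\zeta_p^{y\,\mathrm{Tr}((a+b)x^2+cx^{p^k+1})}+\zeta_p^{y\,\mathrm{Tr}((a-b)\lambda x^2+c\lambda x^{p^k+1})}\big)$. *)

theory Defs
  imports Complex_Main "HOL-Computational_Algebra.Primes"
begin

definition tr :: "nat \<Rightarrow> nat \<Rightarrow> 'a::field \<Rightarrow> 'a" where
  "tr p m x = (\<Sum>i<m. x ^ (p ^ i))"

definition fp_val :: "nat \<Rightarrow> 'a::field \<Rightarrow> nat" where
  "fp_val p x = (THE j. j < p \<and> of_nat j = x)"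

definition zeta :: "nat \<Rightarrow> complex" where
  "zeta p = cis (2 * pi / real p)"

definition S :: "nat \<Rightarrow> nat \<Rightarrow> nat \<Rightarrow> 'a::{field,finite} \<Rightarrow> 'a \<Rightarrow> 'a \<Rightarrow> 'a \<Rightarrow> complex" where
  "S p m k lam a b c =
     (\<Sum>y\<in>{1..<p}. \<Sum>x\<in>(UNIV::'a set).
        zeta p ^ (y * fp_val p (tr p m ((a + b) * x ^ 2 + c * x ^ (p ^ k + 1))))
      + zeta p ^ (y * fp_val p (tr p m ((a - b) * lam * x ^ 2 + c * lam * x ^ (p ^ k + 1)))))"

end

theory Submission
  imports Defs "HOL-Library.FuncSet" "HOL-Computational_Algebra.Polynomial" "HOL-Number_Theory.Cong"
begin

text \<open>Put \<open>T u c = \<Sum>y\<in>Fp*. \<Sum>x. \<zeta>^Tr (y (u x^2 + c x^(p^k+1)))\<close>. Since \<open>\<lambda> \<in> Fp*\<close> can be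
  absorbed into \<open>y\<close>, \<open>S a b c = T (a + b) c + T (a - b) c\<close>, and \<open>(a, b) \<mapsto> (a + b, a - b)\<close> is
  bijective.

  For fixed \<open>u, c\<close> the map \<open>x \<mapsto> Tr (u x^2 + c x^(p^k+1))\<close> is a quadratic form over \<open>Fp\<close>.
  Diagonalising it expresses \<open>T u c\<close> through quadratic Gauss sums: \<open>T u c = 0\<close> if the rank
  \<open>m - r\<close> is odd, and \<open>T u c = \<plusminus>(p - 1) p^r p^((m - r)/2)\<close> otherwise, \<open>p^r\<close> being the size of
  the radical. The radical lies in the kernel of the \<open>Fp\<close>-linear map
  \<open>x \<mapsto> c^(p^k) x^(p^2k) + (2u)^(p^k) x^(p^k) + c x\<close>, which has at most \<open>p^2\<close> elements for
  \<open>c \<noteq> 0\<close> (as \<open>gcd k m = 1\<close>) and is trivial for \<open>c = 0 \<noteq> u\<close>. Since \<open>m\<close> is odd this leaves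
  \<open>T u c \<in> {0, \<plusminus>(p - 1) p^((m+1)/2)}\<close> for \<open>c \<noteq> 0\<close>, \<open>T u 0 = 0\<close> for \<open>u \<noteq> 0\<close> and
  \<open>T 0 0 = (p - 1) p^m\<close>. The moments \<open>\<Sum>u. T u c\<close> and \<open>\<Sum>u. (T u c)^2\<close> determine how often each
  value occurs, and counting pairs \<open>(u, w)\<close> with \<open>T u c + T w c = v\<close> gives the distribution of \<open>S\<close>.\<close>

lemma sum_zero_if_shift_scales:
  fixes f :: "'b \<Rightarrow> 'c::field"
  assumes "bij_betw h A A" "\<And>x. x \<in> A \<Longrightarrow> f (h x) = c * f x" "c \<noteq> 1"
  shows "sum f A = 0"
proof -
  have "sum f A = sum (f \<circ> h) A" using sum.reindex_bij_betw[OF assms(1), of f] by simp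
  also have "\<dots> = c * sum f A" by (simp add: sum_distrib_left assms(2))
  finally have "(1 - c) * sum f A = 0" by (simp add: algebra_simps)
  thus ?thesis using assms(3) by simp
qed

lemma bij_betw_sum_diff:
  fixes A :: "'a::field set"
  assumes "(2::'a) \<noteq> 0"
    and "\<And>x y. x \<in> A \<Longrightarrow> y \<in> A \<Longrightarrow> x + y \<in> A" "\<And>x y. x \<in> A \<Longrightarrow> y \<in> A \<Longrightarrow> x - y \<in> A"
    and "\<And>x. x \<in> A \<Longrightarrow> x / 2 \<in> A"
  shows "bij_betw (\<lambda>(x, y). (x + y, x - y)) (A \<times> A) (A \<times> A)"
proof -
  have "(4::'a) \<noteq> 0" using assms(1) no_zero_divisors[of "2::'a" 2] by simp
  thus ?thesis
    by (intro bij_betwI[where g = "\<lambda>(u, v). ((u + v) / 2, (u - v) / 2)"])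
       (use assms in \<open>auto simp: field_simps\<close>)
qed

lemma sum_swap_innermost:
  "(\<Sum>u\<in>U. \<Sum>a\<in>A. \<Sum>b\<in>B. f u a b) = (\<Sum>a\<in>A. \<Sum>b\<in>B. \<Sum>u\<in>U. (f u a b :: 'c::comm_monoid_add))"
  by (simp only: sum.swap[of _ U] sum.swap[of _ U B])

lemma sum_swap_pairs:
  "(\<Sum>a\<in>A. \<Sum>b\<in>B. \<Sum>c\<in>C. \<Sum>d\<in>D. f a b c d) =
   (\<Sum>c\<in>C. \<Sum>d\<in>D. \<Sum>a\<in>A. \<Sum>b\<in>B. (f a b c d :: 'e::comm_monoid_add))"
proof -
  have "(\<Sum>a\<in>A. \<Sum>b\<in>B. \<Sum>c\<in>C. \<Sum>d\<in>D. f a b c d) = (\<Sum>a\<in>A. \<Sum>c\<in>C. \<Sum>d\<in>D. \<Sum>b\<in>B. f a b c d)"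
    by (intro sum.cong refl sum_swap_innermost)
  also have "\<dots> = (\<Sum>c\<in>C. \<Sum>d\<in>D. \<Sum>a\<in>A. \<Sum>b\<in>B. f a b c d)" by (rule sum_swap_innermost)
  finally show ?thesis .
qed

lemma sum_by_value:
  fixes F :: "'x::finite \<Rightarrow> 'y" and g :: "'y \<Rightarrow> 'b::comm_semiring_1"
  assumes "finite L" "range F \<subseteq> L"
  shows "(\<Sum>u\<in>UNIV. g (F u)) = (\<Sum>t\<in>L. g t * of_nat (card {u. F u = t}))"
proof -
  have "(\<Sum>u\<in>UNIV. g (F u)) = (\<Sum>t\<in>L. \<Sum>u\<in>{x\<in>UNIV. F x = t}. g (F u))"
    by (rule sum.group[symmetric]) (use assms in auto)
  also have "\<dots> = (\<Sum>t\<in>L. g t * of_nat (card {u. F u = t}))"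
    by (rule sum.cong) (auto simp: mult.commute)
  finally show ?thesis .
qed

lemma sum_UNIV_triple:
  "(\<Sum>t\<in>(UNIV::('x::finite \<times> 'y::finite \<times> 'z::finite) set). f t) =
   (\<Sum>a\<in>UNIV. \<Sum>b\<in>UNIV. \<Sum>c\<in>UNIV. (f (a, b, c) :: 'e::comm_monoid_add))"
  by (simp flip: UNIV_Times_UNIV add: sum.cartesian_product')

lemma real_card_eq_sum_of_bool: "real (card {x::'x::finite. P x}) = (\<Sum>x\<in>UNIV. of_bool (P x))"
  by (simp add: of_bool_def sum.If_cases)

lemma sum_plus_minus_reindex:
  fixes f :: "'a::{field,finite} \<Rightarrow> 'a \<Rightarrow> 'b::comm_monoid_add"
  assumes "(2::'a) \<noteq> 0"
  shows "(\<Sum>a\<in>UNIV. \<Sum>b\<in>UNIV. f (a + b) (a - b)) = (\<Sum>u\<in>UNIV. \<Sum>w\<in>UNIV. f u w)"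
proof -
  have "(\<Sum>a\<in>UNIV. \<Sum>b\<in>UNIV. f (a + b) (a - b)) = (\<Sum>ab\<in>UNIV \<times> UNIV. case_prod f ((\<lambda>(x, y). (x + y, x - y)) ab))"
    by (simp add: sum.cartesian_product case_prod_beta)
  also have "\<dots> = (\<Sum>uw\<in>UNIV \<times> UNIV. case_prod f uw)"
    by (rule sum.reindex_bij_betw[OF bij_betw_sum_diff[where A = UNIV, OF assms UNIV_I UNIV_I UNIV_I]])
  also have "\<dots> = (\<Sum>u\<in>UNIV. \<Sum>w\<in>UNIV. f u w)" by (rule sum.cartesian_product[symmetric])
  finally show ?thesis .
qed

locale galois_field =
  fixes p m :: nat and ty :: "'a::{field,finite} itself"
  assumes prime_p: "prime p" and odd_p: "odd p"
    and card_UNIV: "card (UNIV::'a set) = p ^ m" and char_p: "of_nat p = (0::'a)" and m_pos: "m \<ge> 1"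
begin

lemma CHAR_eq_p: "CHAR('a) = p"
proof -
  have "CHAR('a) > 0" by (simp add: finite_imp_CHAR_pos)
  hence "prime CHAR('a)" using prime_CHAR_semidom by blast
  moreover have "CHAR('a) dvd p" using char_p by (simp add: of_nat_eq_0_iff_char_dvd)
  ultimately show ?thesis using prime_p primes_dvd_imp_eq by blast
qed

lemma p_gt1: "p > 1" using prime_p prime_gt_1_nat by blast
lemma p_ge3: "p \<ge> 3" using odd_p p_gt1 by presburger

lemma of_nat_eq_iff_mod: "(of_nat i::'a) = of_nat j \<longleftrightarrow> i mod p = j mod p"
  using of_nat_eq_iff_cong_CHAR[where 'a='a, of i j] CHAR_eq_p by (simp add: cong_def)

lemma of_nat_eq_0_iff_dvd: "(of_nat i::'a) = 0 \<longleftrightarrow> p dvd i"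
  using of_nat_eq_0_iff_char_dvd CHAR_eq_p by metis

lemma two_neq_zero: "(2::'a) \<noteq> 0"
proof
  assume "(2::'a) = 0"
  hence "p dvd 2" using of_nat_eq_0_iff_dvd[of 2] by simp
  thus False using p_ge3 dvd_imp_le[of p 2] by simp
qed

subsection \<open>Frobenius\<close>

lemma frobenius_add: "(x + y::'a) ^ (p ^ n) = x ^ (p ^ n) + y ^ (p ^ n)"
  by (rule freshmans_dream') (simp_all add: CHAR_eq_p prime_p)

lemma frobenius_sum: "(sum f A :: 'a) ^ (p ^ n) = (\<Sum>i\<in>A. f i ^ (p ^ n))"
  by (rule freshmans_dream_sum') (simp_all add: CHAR_eq_p prime_p)

lemma frobenius_uminus: "(- x::'a) ^ (p ^ n) = - (x ^ (p ^ n))"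
  using odd_p by (simp add: power_minus_odd)

lemma frobenius_diff: "(x - y::'a) ^ (p ^ n) = x ^ (p ^ n) - y ^ (p ^ n)"
  using frobenius_add[of x "-y" n] frobenius_uminus[of y n] by simp

lemma frobenius_inj: "(x::'a) ^ (p ^ n) = y ^ (p ^ n) \<Longrightarrow> x = y"
  using frobenius_diff[of x y n] by (metis eq_iff_diff_eq_0 power_eq_0_iff)

lemma frobenius_surj: "\<exists>z::'a. z ^ (p ^ n) = w"
proof -
  have "inj (\<lambda>z::'a. z ^ (p ^ n))" by (auto intro: injI frobenius_inj)
  hence "surj (\<lambda>z::'a. z ^ (p ^ n))" by (simp add: finite_UNIV_inj_surj)
  thus ?thesis by (metis surjD)
qed

text \<open>The multiplicative group has order \<open>card UNIV - 1\<close>; multiplying all its elements by \<open>x\<close> permutes them.\<close>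
lemma power_card_UNIV: "(x::'a) ^ card (UNIV::'a set) = x"
proof (cases "x = 0")
  case False
  have "x * (\<Prod>y\<in>UNIV-{0}. x * y) = x * x ^ (card (UNIV :: 'a set) - 1) * \<Prod>(UNIV-{0})"
    by (simp add: prod.distrib mult_ac)
  also have "x * x ^ (card (UNIV :: 'a set) - 1) = x ^ Suc (card (UNIV :: 'a set) - 1)"
    by (subst power_Suc) auto
  also have "Suc (card (UNIV :: 'a set) - 1) = card (UNIV :: 'a set)"
    using finite_UNIV_card_ge_0[where ?'a = 'a] by simp
  also have "(\<Prod>y\<in>UNIV-{0}. x * y) = (\<Prod>y\<in>UNIV-{0}. y)"
    by (rule prod.reindex_bij_witness[of _ "\<lambda>y. y / x" "\<lambda>y. x * y"]) (use False in auto)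
  finally show ?thesis
    by simp
qed (use finite_UNIV_card_ge_0[where ?'a = 'a] in auto)

lemma power_p_m: "(x::'a) ^ (p ^ m) = x"
  using power_card_UNIV card_UNIV by simp

lemma card_UNIV_pos: "card (UNIV::'a set) > 0" by (rule finite_UNIV_card_ge_0) simp

subsection \<open>The prime field\<close>

definition Fp :: "'a set" where "Fp = range of_nat"

lemma Fp_eq_image: "Fp = of_nat ` {..<p}"
proof -
  have "(of_nat j::'a) \<in> of_nat ` {..<p}" for j
  proof -
    have "(of_nat j::'a) = of_nat (j mod p)" using of_nat_eq_iff_mod by simp
    moreover have "j mod p < p" using p_gt1 by simp
    ultimately show ?thesis by (metis image_eqI lessThan_iff)
  qed
  thus ?thesis unfolding Fp_def by auto
qed

lemma inj_on_of_nat_Fp: "inj_on (of_nat::nat\<Rightarrow>'a) {..<p}"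
  by (auto simp: inj_on_def of_nat_eq_iff_mod)

lemma card_Fp: "card Fp = p"
  unfolding Fp_eq_image using card_image[OF inj_on_of_nat_Fp] by simp

lemma Fp_obtain: assumes "x \<in> Fp" obtains j where "x = of_nat j" "j < p"
  using assms Fp_eq_image by auto

lemma of_nat_power_p: "(of_nat j::'a) ^ p = of_nat j"
proof (induction j)
  case (Suc j)
  have "(of_nat (Suc j)::'a) ^ p = (of_nat j + 1) ^ (p ^ 1)" by (simp add: add.commute)
  also have "\<dots> = of_nat j ^ (p^1) + 1 ^ (p^1)" by (rule frobenius_add)
  finally show ?case using Suc by (simp add: add.commute)
qed (use p_gt1 in auto)

text \<open>\<open>Fp\<close> already fills up the \<open>p\<close> possible roots of \<open>X\<^sup>p - X\<close>.\<close>
lemma Fp_iff_power_p: "x \<in> Fp \<longleftrightarrow> (x::'a) ^ p = x"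
proof
  assume "x \<in> Fp" thus "x ^ p = x" unfolding Fp_def using of_nat_power_p by auto
next
  assume x: "x ^ p = x"
  define P where "P = monom (1::'a) p + [:0,-1:]"
  have dP: "degree P = p" unfolding P_def using p_gt1
    by (subst degree_add_eq_left) (simp_all add: degree_monom_eq)
  have P0: "P \<noteq> 0" using dP p_gt1 by auto
  have roots: "{y. poly P y = 0} = {y. y ^ p = y}" unfolding P_def by (auto simp: poly_monom)
  have sub: "Fp \<subseteq> {y. y ^ p = y}" unfolding Fp_def using of_nat_power_p by auto
  have "card {y::'a. y ^ p = y} \<le> p" using card_poly_roots_bound[OF P0] dP roots by simp
  hence "Fp = {y. y ^ p = y}" using card_Fp sub by (intro card_seteq) auto
  thus "x \<in> Fp" using x by auto
qed

lemma Fp_power_p_power: "x \<in> Fp \<Longrightarrow> x ^ (p ^ n) = x"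
proof (induction n)
  case (Suc n)
  have "x ^ (p ^ Suc n) = (x ^ (p ^ n)) ^ p" by (simp add: power_mult[symmetric] mult.commute)
  thus ?case using Suc Fp_iff_power_p by simp
qed simp

lemma Fp_of_nat [simp]: "of_nat n \<in> Fp"
  unfolding Fp_def by simp

lemma Fp_0 [simp]: "0 \<in> Fp" and Fp_1 [simp]: "1 \<in> Fp"
  using Fp_of_nat[of 0] Fp_of_nat[of 1] by simp_all

lemma Fp_numeral [simp]: "numeral j \<in> Fp"
  using Fp_of_nat[of "numeral j"] by simp

lemma Fp_add: "x \<in> Fp \<Longrightarrow> y \<in> Fp \<Longrightarrow> x + y \<in> Fp"
  using frobenius_add[of x y 1] Fp_iff_power_p by simp
lemma Fp_uminus: "x \<in> Fp \<Longrightarrow> - x \<in> Fp"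
  using frobenius_uminus[of x 1] Fp_iff_power_p by simp
lemma Fp_diff: "x \<in> Fp \<Longrightarrow> y \<in> Fp \<Longrightarrow> x - y \<in> Fp"
  using frobenius_diff[of x y 1] Fp_iff_power_p by simp
lemma Fp_mult: "x \<in> Fp \<Longrightarrow> y \<in> Fp \<Longrightarrow> x * y \<in> Fp"
  using Fp_iff_power_p by (simp add: power_mult_distrib)
lemma Fp_divide: "x \<in> Fp \<Longrightarrow> y \<in> Fp \<Longrightarrow> x / y \<in> Fp"
  using Fp_iff_power_p by (simp add: power_divide)
lemma Fp_power: "x \<in> Fp \<Longrightarrow> x ^ n \<in> Fp"
  using Fp_iff_power_p by (metis power_mult power_mult[symmetric] mult.commute)

definition Fp_units :: "'a set" where "Fp_units = Fp - {0}"

lemma card_Fp_units: "card Fp_units = p - 1"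
  unfolding Fp_units_def using card_Fp by (simp add: card_Diff_singleton)

lemma Fp_units_neq_0: "y \<in> Fp_units \<Longrightarrow> y \<noteq> 0" and Fp_units_in_Fp: "y \<in> Fp_units \<Longrightarrow> y \<in> Fp"
  unfolding Fp_units_def by auto

lemma Fp_units_mult: "x \<in> Fp_units \<Longrightarrow> y \<in> Fp_units \<Longrightarrow> x * y \<in> Fp_units"
  unfolding Fp_units_def by (auto simp: Fp_mult)

lemma frobenius_fixed_mult: "(x::'a) ^ (p ^ a) = x \<Longrightarrow> x ^ (p ^ (a * u)) = x"
proof (induction u)
  case (Suc u)
  have "x ^ (p ^ (a * Suc u)) = (x ^ (p ^ (a * u))) ^ (p ^ a)"
    by (simp add: power_add power_mult[symmetric] mult.commute)
  thus ?case using Suc by simp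
qed simp

lemma frobenius_fixed_gcd:
  assumes a: "(x::'a) ^ (p ^ a) = x" and b: "x ^ (p ^ b) = x"
  shows "x ^ (p ^ gcd a b) = x"
proof (cases "a = 0")
  case True thus ?thesis using b by simp
next
  case False
  obtain u v where uv: "a * u = b * v + gcd a b" using bezout_nat[OF False] by blast
  have "x = x ^ (p ^ (a * u))" using frobenius_fixed_mult[OF a] by simp
  also have "\<dots> = (x ^ (p ^ gcd a b)) ^ (p ^ (b * v))"
    by (simp add: uv power_add power_mult[symmetric] mult.commute)
  finally have "(x ^ (p ^ gcd a b)) ^ (p ^ (b * v)) = x ^ (p ^ (b * v))"
    using frobenius_fixed_mult[OF b] by simp
  thus ?thesis by (rule frobenius_inj)
qed

lemma Fp_if_frobenius_fixed:
  assumes "(x::'a) ^ (p ^ a) = x" and "coprime a m"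
  shows "x \<in> Fp"
  using frobenius_fixed_gcd[OF assms(1) power_p_m] assms(2) Fp_iff_power_p by simp

text \<open>For odd \<open>m\<close> the field contains no quadratic extension of \<open>Fp\<close>.\<close>
lemma Fp_if_square_in_Fp:
  assumes "odd m" and t: "t ^ 2 \<in> Fp"
  shows "t \<in> Fp"
proof -
  have "(t ^ p) ^ 2 = t ^ 2" using t Fp_iff_power_p by (simp add: power_mult[symmetric] mult.commute)
  hence "t ^ p = t \<or> t ^ p = - t" by (simp add: power2_eq_iff)
  thus ?thesis
  proof
    assume "t ^ p = - t"
    hence "t ^ (p ^ 2) = t" using frobenius_uminus[of t 1] by (simp add: power2_eq_square power_mult)
    moreover have "coprime 2 m" using \<open>odd m\<close> by (simp add: coprime_commute)
    ultimately show ?thesis by (rule Fp_if_frobenius_fixed)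
  qed (simp add: Fp_iff_power_p)
qed

lemma card_le_p_squared_by_fibres:
  fixes f :: "'a \<Rightarrow> 'a" and X E :: "'a set"
  assumes "f ` X \<subseteq> E" "card E \<le> p"
    and fib: "\<And>x x'. x \<in> X \<Longrightarrow> x' \<in> X \<Longrightarrow> f x = f x' \<Longrightarrow> x' \<in> (\<lambda>s. x + s * d) ` Fp"
  shows "card X \<le> p ^ 2"
proof -
  have X: "X = (\<Union>e\<in>f ` X. {x\<in>X. f x = e})" by auto
  have "card X \<le> (\<Sum>e\<in>f ` X. card {x\<in>X. f x = e})"
    by (subst X) (rule card_UN_le, simp)
  also have "\<dots> \<le> (\<Sum>e\<in>f ` X. p)"
  proof (rule sum_mono)
    fix e assume "e \<in> f ` X"
    then obtain x0 where x0: "x0 \<in> X" "e = f x0" by auto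
    have "{x\<in>X. f x = e} \<subseteq> (\<lambda>s. x0 + s * d) ` Fp" using fib x0 by auto
    hence "card {x\<in>X. f x = e} \<le> card ((\<lambda>s. x0 + s * d) ` Fp)" by (simp add: card_mono)
    also have "\<dots> \<le> card Fp" by (rule card_image_le) simp
    finally show "card {x\<in>X. f x = e} \<le> p" using card_Fp by simp
  qed
  also have "\<dots> = card (f ` X) * p" by simp
  also have "\<dots> \<le> card E * p" using assms(1) by (simp add: card_mono)
  also have "\<dots> \<le> p * p" using assms(2) by simp
  finally show ?thesis by (simp add: power2_eq_square)
qed

subsection \<open>The additive character of the prime field\<close>

lemma fp_val_of_nat: "fp_val p (of_nat j :: 'a) = j mod p"
  unfolding fp_val_def
proof (rule the_equality)
  show "j mod p < p \<and> (of_nat (j mod p)::'a) = of_nat j" using p_gt1 of_nat_eq_iff_mod by simp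
next
  fix i assume "i < p \<and> (of_nat i::'a) = of_nat j"
  thus "i = j mod p" using of_nat_eq_iff_mod by auto
qed

lemma zeta_power_p: "zeta p ^ p = 1"
proof -
  have "zeta p ^ p = cis (real p * (2 * pi / real p))" unfolding zeta_def by (rule DeMoivre)
  also have "real p * (2 * pi / real p) = 2 * pi" using p_gt1 by simp
  finally show ?thesis by simp
qed

lemma zeta_power_mod: "zeta p ^ (j mod p) = zeta p ^ j"
proof -
  have "zeta p ^ j = zeta p ^ (p * (j div p) + j mod p)" by simp
  also have "\<dots> = zeta p ^ (j mod p)" by (simp only: power_add power_mult zeta_power_p) simp
  finally show ?thesis by simp
qed

lemma zeta_power_neq_1: assumes "0 < j" "j < p" shows "zeta p ^ j \<noteq> 1"
proof
  assume "zeta p ^ j = 1"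
  hence "cis (real j * (2 * pi / real p)) = 1" unfolding zeta_def by (simp add: DeMoivre)
  hence "cos (real j * (2 * pi / real p)) = 1" by (metis cis.sel(1) one_complex.sel(1))
  then obtain n :: int where n: "real j * (2 * pi / real p) = of_int n * 2 * pi" using cos_one_2pi_int by auto
  hence "real j = n * real p" using p_gt1 by (simp add: field_simps)
  hence "int j = n * int p" by (metis of_int_eq_iff of_int_mult of_int_of_nat_eq)
  moreover have "n > 0" using \<open>real j = n * real p\<close> assms p_gt1
    by (smt (verit) of_nat_0_less_iff mult_nonpos_nonneg of_int_le_0_iff of_nat_0_le_iff)
  ultimately have "int j \<ge> int p" by (smt (verit) mult_le_cancel_right1 of_nat_0_le_iff)
  thus False using assms by simp
qed

definition psi :: "'a \<Rightarrow> complex" where "psi x = zeta p ^ fp_val p x"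

lemma psi_of_nat: "psi (of_nat j) = zeta p ^ j"
  unfolding psi_def fp_val_of_nat zeta_power_mod ..

lemma psi_add: "x \<in> Fp \<Longrightarrow> y \<in> Fp \<Longrightarrow> psi (x + y) = psi x * psi y"
  by (metis Fp_obtain psi_of_nat of_nat_add power_add)

lemma psi_0 [simp]: "psi 0 = 1" using psi_of_nat[of 0] by simp

lemma psi_neq_1: "x \<in> Fp \<Longrightarrow> x \<noteq> 0 \<Longrightarrow> psi x \<noteq> 1"
  by (metis Fp_obtain psi_of_nat zeta_power_neq_1 of_nat_0 neq0_conv)

lemma zeta_power_fp_val: assumes "t \<in> Fp" shows "zeta p ^ (y * fp_val p t) = psi (of_nat y * t)"
proof -
  obtain j where j: "t = of_nat j" "j < p" using Fp_obtain[OF assms] by blast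
  have "zeta p ^ (y * fp_val p t) = zeta p ^ (y * j)" using j fp_val_of_nat by simp
  also have "\<dots> = psi (of_nat (y * j))" by (simp only: psi_of_nat)
  also have "\<dots> = psi (of_nat y * t)" using j by simp
  finally show ?thesis .
qed

lemma of_nat_image_Fp_units: "(of_nat :: nat \<Rightarrow> 'a) ` {1..<p} = Fp_units"
proof (intro set_eqI iffI)
  fix x assume "x \<in> (of_nat :: nat \<Rightarrow> 'a) ` {1..<p}"
  then obtain j where j: "j \<in> {1..<p}" "x = of_nat j" by auto
  have "x \<noteq> 0" using j of_nat_eq_0_iff_dvd by (auto dest: dvd_imp_le)
  thus "x \<in> Fp_units" unfolding Fp_units_def using j by simp
next
  fix x assume "x \<in> Fp_units"
  then obtain j where j: "x = of_nat j" "j < p" "x \<noteq> 0" unfolding Fp_units_def using Fp_obtain by blast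
  hence "j \<noteq> 0" by (metis of_nat_0)
  thus "x \<in> (of_nat :: nat \<Rightarrow> 'a) ` {1..<p}" using j by auto
qed

lemma inj_on_of_nat_Fp_units: "inj_on (of_nat :: nat \<Rightarrow> 'a) {1..<p}"
  using inj_on_of_nat_Fp by (rule inj_on_subset) auto

lemma sum_Fp_units_of_nat: "(\<Sum>y\<in>{1..<p}. g (of_nat y :: 'a)) = (\<Sum>y\<in>Fp_units. g y)"
  using sum.reindex[OF inj_on_of_nat_Fp_units, of g] of_nat_image_Fp_units by simp

subsection \<open>The absolute trace\<close>

abbreviation Tr :: "'a \<Rightarrow> 'a" where "Tr \<equiv> tr p m"

lemma tr_add: "Tr (x + y) = Tr x + Tr y"
  unfolding tr_def by (simp add: frobenius_add sum.distrib)

lemma tr_diff: "Tr (x - y) = Tr x - Tr y"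
  unfolding tr_def by (simp add: frobenius_diff sum_subtractf)

lemma tr_0 [simp]: "Tr 0 = 0"
  unfolding tr_def using p_gt1 by (simp add: power_0_left)

lemma tr_in_Fp: "Tr x \<in> Fp"
proof -
  let ?f = "\<lambda>i. x ^ (p ^ i)"
  have "(Tr x) ^ (p ^ 1) = (\<Sum>i<m. ?f i ^ (p ^ 1))" unfolding tr_def by (rule frobenius_sum)
  also have "\<dots> = (\<Sum>i<m. ?f (Suc i))" by (simp add: power_mult[symmetric] mult.commute)
  also have "\<dots> = (\<Sum>i<m. ?f i)"
  proof -
    have "(\<Sum>i<Suc m. ?f i) = ?f 0 + (\<Sum>i<m. ?f (Suc i))" by (rule sum.lessThan_Suc_shift)
    moreover have "(\<Sum>i<Suc m. ?f i) = (\<Sum>i<m. ?f i) + ?f m" by simp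
    moreover have "?f m = ?f 0" using power_p_m by simp
    ultimately show ?thesis by simp
  qed
  finally show ?thesis unfolding tr_def using Fp_iff_power_p by simp
qed

lemma tr_Fp_mult: "s \<in> Fp \<Longrightarrow> Tr (s * x) = s * Tr x"
  unfolding tr_def by (simp add: power_mult_distrib Fp_power_p_power sum_distrib_left)

lemma tr_frobenius: "Tr (x ^ (p ^ j)) = Tr x"
proof -
  have "Tr (x ^ (p ^ j)) = (\<Sum>i<m. (x ^ (p ^ i)) ^ (p ^ j))"
    unfolding tr_def by (simp add: power_mult[symmetric] mult.commute)
  also have "\<dots> = (Tr x) ^ (p ^ j)" unfolding tr_def by (rule frobenius_sum[symmetric])
  also have "\<dots> = Tr x" using Fp_power_p_power tr_in_Fp by simp
  finally show ?thesis .
qed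

lemma degree_trace_poly: "n \<ge> 1 \<Longrightarrow> degree (\<Sum>i<n. monom (1::'a) (p ^ i)) = p ^ (n - 1)"
proof (induction n)
  case (Suc n)
  show ?case
  proof (cases "n = 0")
    case True thus ?thesis by (simp add: degree_monom_eq)
  next
    case False
    hence "degree (\<Sum>i<n. monom (1::'a) (p ^ i)) = p ^ (n - 1)" using Suc by simp
    moreover have "p ^ (n - 1) < p ^ n" using p_gt1 False by simp
    ultimately have "degree ((\<Sum>i<n. monom (1::'a) (p ^ i)) + monom 1 (p ^ n)) = p ^ n"
      by (subst degree_add_eq_right) (simp_all add: degree_monom_eq)
    thus ?thesis by simp
  qed
qed simp

lemma tr_not_identically_zero: "\<exists>x. Tr x \<noteq> 0"
proof (rule ccontr)
  assume "\<not> ?thesis"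
  hence all: "\<forall>x. Tr x = 0" by simp
  define P where "P = (\<Sum>i<m. monom (1::'a) (p ^ i))"
  have dP: "degree P = p ^ (m - 1)" unfolding P_def using degree_trace_poly m_pos by simp
  have P0: "P \<noteq> 0"
  proof
    assume "P = 0"
    hence "p ^ (m - 1) = 0" using dP by simp
    thus False using p_gt1 by simp
  qed
  have "poly P x = Tr x" for x unfolding P_def tr_def by (simp add: poly_sum poly_monom)
  hence "{x. poly P x = 0} = UNIV" using all by auto
  hence "card (UNIV::'a set) \<le> p ^ (m - 1)" using card_poly_roots_bound[OF P0] dP by simp
  moreover have "p ^ (m - 1) < p ^ m" using p_gt1 m_pos by simp
  ultimately show False using card_UNIV by simp
qed

lemma tr_nondegenerate: "a \<noteq> 0 \<Longrightarrow> \<exists>x. Tr (a * x) \<noteq> 0"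
proof -
  assume a: "a \<noteq> 0"
  obtain x where "Tr x \<noteq> 0" using tr_not_identically_zero by blast
  hence "Tr (a * (x / a)) \<noteq> 0" using a by simp
  thus ?thesis by blast
qed

lemma sum_psi_tr: "(\<Sum>x\<in>UNIV. psi (Tr (a * x))) = (if a = 0 then of_nat (card (UNIV::'a set)) else 0)"
proof (cases "a = 0")
  case False
  obtain z where z: "Tr (a * z) \<noteq> 0" using tr_nondegenerate[OF False] by blast
  have "(\<Sum>x\<in>UNIV. psi (Tr (a * x))) = 0"
  proof (rule sum_zero_if_shift_scales[where h = "\<lambda>x. x + z" and c = "psi (Tr (a * z))"])
    show "bij_betw (\<lambda>x. x + z) UNIV (UNIV::'a set)"
      by (rule bij_betwI[where g = "\<lambda>x. x - z"]) auto
    show "psi (Tr (a * (x + z))) = psi (Tr (a * z)) * psi (Tr (a * x))" for x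
      by (simp add: distrib_left tr_add psi_add tr_in_Fp mult.commute)
    show "psi (Tr (a * z)) \<noteq> 1" using psi_neq_1 tr_in_Fp z by blast
  qed
  thus ?thesis using False by simp
qed simp

lemma sum_psi_Fp: assumes "t \<in> Fp" shows "(\<Sum>s\<in>Fp. psi (s * t)) = (if t = 0 then of_nat p else 0)"
proof (cases "t = 0")
  case True thus ?thesis by (simp add: card_Fp)
next
  case False
  have "(\<Sum>s\<in>Fp. psi (s * t)) = 0"
  proof (rule sum_zero_if_shift_scales[where h = "\<lambda>s. s + 1" and c = "psi t"])
    show "bij_betw (\<lambda>s. s + 1) Fp Fp"
      by (rule bij_betwI[where g = "\<lambda>x. x - 1"]) (auto intro: Fp_add Fp_diff)
    show "psi ((s + 1) * t) = psi t * psi (s * t)" if "s \<in> Fp" for s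
    proof -
      have "psi ((s + 1) * t) = psi (s * t + t)" by (simp add: distrib_right)
      also have "\<dots> = psi (s * t) * psi t" using psi_add Fp_mult that assms by blast
      finally show ?thesis by simp
    qed
    show "psi t \<noteq> 1" using psi_neq_1 assms False by blast
  qed
  thus ?thesis using False by simp
qed

subsection \<open>Squares and quadratic Gauss sums over the prime field\<close>

definition Fp_squares :: "'a set" where "Fp_squares = {t\<in>Fp_units. \<exists>b\<in>Fp. b ^ 2 = t}"

definition eta :: "'a \<Rightarrow> complex" where "eta y = (if y \<in> Fp_squares then 1 else -1)"

lemma Fp_squares_subset: "Fp_squares \<subseteq> Fp_units" unfolding Fp_squares_def by auto

lemma neq_uminus_self: assumes "(b::'a) \<noteq> 0" shows "b \<noteq> - b"
proof
  assume "b = - b"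
  hence "2 * b = 0" by (metis mult_2 right_minus)
  thus False using two_neq_zero assms by simp
qed

lemma card_Fp_squares: "2 * card Fp_squares = p - 1"
proof -
  define roots where "roots t = {s\<in>Fp_units. s ^ 2 = t}" for t
  have units: "Fp_units = (\<Union>t\<in>Fp_squares. roots t)"
  proof
    show "Fp_units \<subseteq> (\<Union>t\<in>Fp_squares. roots t)"
    proof
      fix s assume s: "s \<in> Fp_units"
      hence "s ^ 2 \<in> Fp_squares" using Fp_units_mult[OF s s] Fp_units_in_Fp[OF s]
        unfolding Fp_squares_def by (auto simp: power2_eq_square)
      moreover have "s \<in> roots (s ^ 2)" unfolding roots_def using s by blast
      ultimately show "s \<in> (\<Union>t\<in>Fp_squares. roots t)" by blast
    qed
    show "(\<Union>t\<in>Fp_squares. roots t) \<subseteq> Fp_units" unfolding roots_def by blast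
  qed
  have "card (roots t) = 2" if t: "t \<in> Fp_squares" for t
  proof -
    obtain b where b: "b \<in> Fp" "b ^ 2 = t" "t \<noteq> 0" using t unfolding Fp_squares_def Fp_units_def by blast
    hence b0: "b \<noteq> 0" by auto
    have "- b \<in> Fp_units" "b \<in> Fp_units" using b b0 Fp_uminus unfolding Fp_units_def by auto
    hence "roots t = {b, - b}" unfolding roots_def b(2)[symmetric] using power2_eq_iff by blast
    thus ?thesis using neq_uminus_self[OF b0] by simp
  qed
  moreover have "card Fp_units = (\<Sum>t\<in>Fp_squares. card (roots t))"
    unfolding units by (rule card_UN_disjoint) (auto simp: roots_def)
  ultimately show ?thesis using card_Fp_units by simp
qed

lemma card_Fp_nonsquares: "card (Fp_units - Fp_squares) = card Fp_squares"
  using card_Fp_squares card_Fp_units Fp_squares_subset by (simp add: card_Diff_subset)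

lemma Fp_squares_mult: assumes "x \<in> Fp_squares" "y \<in> Fp_squares" shows "x * y \<in> Fp_squares"
proof -
  obtain b c where "b \<in> Fp" "c \<in> Fp" "b ^ 2 = x" "c ^ 2 = y" using assms unfolding Fp_squares_def by blast
  hence "b * c \<in> Fp" "(b * c) ^ 2 = x * y" by (simp_all add: Fp_mult power_mult_distrib)
  thus ?thesis using assms Fp_units_mult unfolding Fp_squares_def by blast
qed

lemma Fp_squares_mult_nonsquare:
  assumes x: "x \<in> Fp_squares" and y: "y \<in> Fp_units - Fp_squares"
  shows "x * y \<in> Fp_units - Fp_squares"
proof -
  obtain b where b: "b \<in> Fp" "b \<noteq> 0" "x = b ^ 2" using x unfolding Fp_squares_def Fp_units_def by force
  have "y \<in> Fp_squares" if xy: "x * y \<in> Fp_squares"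
  proof -
    obtain c where c: "c \<in> Fp" "c ^ 2 = x * y" using xy unfolding Fp_squares_def by blast
    have "(c / b) ^ 2 = y" using b c by (simp add: power_divide)
    thus ?thesis using y b c Fp_divide unfolding Fp_squares_def by auto
  qed
  thus ?thesis using x y Fp_squares_subset Fp_units_mult by blast
qed

lemma Fp_nonsquare_exists: "\<exists>\<nu>. \<nu> \<in> Fp_units - Fp_squares"
proof (rule ccontr)
  assume "\<nexists>\<nu>. \<nu> \<in> Fp_units - Fp_squares"
  hence "card Fp_units \<le> card Fp_squares" by (intro card_mono) auto
  thus False using card_Fp_squares card_Fp_units p_ge3 by simp
qed

lemma Fp_nonsquares_eq_coset:
  assumes nu: "\<nu> \<in> Fp_units - Fp_squares"
  shows "Fp_units - Fp_squares = (\<lambda>x. \<nu> * x) ` Fp_squares"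
proof -
  have sub: "(\<lambda>x. \<nu> * x) ` Fp_squares \<subseteq> Fp_units - Fp_squares"
    using Fp_squares_mult_nonsquare[OF _ nu] by (auto simp: mult.commute)
  have "inj_on (\<lambda>x. \<nu> * x) Fp_squares" using nu Fp_units_neq_0 by (auto simp: inj_on_def)
  hence "card ((\<lambda>x. \<nu> * x) ` Fp_squares) = card (Fp_units - Fp_squares)"
    by (simp add: card_image card_Fp_nonsquares)
  thus ?thesis using sub by (intro card_subset_eq[symmetric]) auto
qed

lemma eta_mult:
  assumes x: "x \<in> Fp_units" and y: "y \<in> Fp_units"
  shows "eta (x * y) = eta x * eta y"
proof -
  obtain \<nu> where nu: "\<nu> \<in> Fp_units - Fp_squares" using Fp_nonsquare_exists by blast
  have nonsq_mult: "x * y \<in> Fp_squares" if "x \<in> Fp_units - Fp_squares" "y \<in> Fp_units - Fp_squares" for x y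
  proof -
    have "x \<in> (\<lambda>x. \<nu> * x) ` Fp_squares" "y \<in> (\<lambda>x. \<nu> * x) ` Fp_squares"
      using that Fp_nonsquares_eq_coset[OF nu] by simp_all
    then obtain a b where ab: "a \<in> Fp_squares" "b \<in> Fp_squares" "x = \<nu> * a" "y = \<nu> * b"
      by (elim imageE)
    have "\<nu> * \<nu> \<in> Fp_squares"
      unfolding Fp_squares_def mem_Collect_eq using nu Fp_units_mult[of \<nu> \<nu>] Fp_units_in_Fp[of \<nu>]
      by (intro conjI bexI[of _ \<nu>]) (simp_all add: power2_eq_square)
    hence "(\<nu> * \<nu>) * (a * b) \<in> Fp_squares" by (rule Fp_squares_mult[OF _ Fp_squares_mult[OF ab(1) ab(2)]])
    moreover have "x * y = (\<nu> * \<nu>) * (a * b)" using ab(3,4) by (simp add: mult_ac)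
    ultimately show ?thesis by simp
  qed
  show ?thesis
  proof (cases "x \<in> Fp_squares"; cases "y \<in> Fp_squares")
    assume "x \<in> Fp_squares" "y \<in> Fp_squares"
    thus ?thesis unfolding eta_def using Fp_squares_mult by simp
  next
    assume "x \<in> Fp_squares" "y \<notin> Fp_squares"
    thus ?thesis unfolding eta_def using Fp_squares_mult_nonsquare[of x y] y by simp
  next
    assume "x \<notin> Fp_squares" "y \<in> Fp_squares"
    thus ?thesis unfolding eta_def using Fp_squares_mult_nonsquare[of y x] x by (simp add: mult.commute)
  next
    assume "x \<notin> Fp_squares" "y \<notin> Fp_squares"
    thus ?thesis unfolding eta_def using nonsq_mult x y by simp
  qed
qed

lemma eta_squared: "eta y ^ 2 = 1" unfolding eta_def by simp

lemma sum_eta: "(\<Sum>y\<in>Fp_units. eta y) = 0"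
proof -
  have "(\<Sum>y\<in>Fp_units. eta y) = (\<Sum>y\<in>Fp_squares. eta y) + (\<Sum>y\<in>Fp_units - Fp_squares. eta y)"
    using Fp_squares_subset by (metis add.commute finite sum.subset_diff)
  also have "\<dots> = of_nat (card Fp_squares) - of_nat (card (Fp_units - Fp_squares))" unfolding eta_def by simp
  finally show ?thesis using card_Fp_nonsquares by simp
qed

lemma sum_eta_power: "(\<Sum>y\<in>Fp_units. eta y ^ n) = (if even n then of_nat (p - 1) else 0)"
proof (cases "even n")
  case True
  then obtain j where "n = 2 * j" by blast
  hence "eta y ^ n = 1" for y by (simp add: power_mult eta_squared)
  thus ?thesis using True card_Fp_units by simp
next
  case False
  then obtain j where "n = 2 * j + 1" using oddE by blast
  hence "eta y ^ n = eta y" for y by (simp add: power_mult eta_squared)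
  thus ?thesis using False sum_eta by simp
qed

definition gauss :: "'a \<Rightarrow> complex" where "gauss a = (\<Sum>s\<in>Fp. psi (a * s ^ 2))"

lemma gauss_mult_square: assumes "a \<in> Fp" "b \<in> Fp" "b \<noteq> 0" shows "gauss (a * b ^ 2) = gauss a"
proof -
  have bij: "bij_betw (\<lambda>s. b * s) Fp Fp"
    by (rule bij_betwI[where g = "\<lambda>s. s / b"]) (use assms in \<open>auto simp: Fp_mult Fp_divide\<close>)
  have "gauss a = (\<Sum>s\<in>Fp. psi (a * (b * s) ^ 2))"
    unfolding gauss_def using sum.reindex_bij_betw[OF bij, of "\<lambda>s. psi (a * s ^ 2)"] by simp
  also have "\<dots> = gauss (a * b ^ 2)" unfolding gauss_def by (simp add: power_mult_distrib mult_ac)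
  finally show ?thesis by simp
qed

lemma gauss_square: "t \<in> Fp_squares \<Longrightarrow> gauss t = gauss 1"
proof -
  assume "t \<in> Fp_squares"
  then obtain b where b: "b \<in> Fp" "b ^ 2 = t" "b \<noteq> 0" unfolding Fp_squares_def Fp_units_def by auto
  thus ?thesis using gauss_mult_square[of 1 b] by simp
qed

text \<open>In \<open>\<Sum>y\<in>Fp. gauss y\<close> only the terms with \<open>s = 0\<close> survive, giving \<open>p = gauss 0\<close>.\<close>
lemma sum_gauss: "(\<Sum>y\<in>Fp_units. gauss y) = 0"
proof -
  have "(\<Sum>y\<in>Fp. gauss y) = (\<Sum>s\<in>Fp. \<Sum>y\<in>Fp. psi (y * s ^ 2))" unfolding gauss_def by (rule sum.swap)
  also have "\<dots> = (\<Sum>s\<in>Fp. if s ^ 2 = 0 then of_nat p else 0)"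
    by (rule sum.cong) (simp_all add: sum_psi_Fp Fp_power)
  also have "\<dots> = of_nat p" by (simp add: sum.delta)
  finally have "(\<Sum>y\<in>Fp. gauss y) = of_nat p" .
  moreover have "(\<Sum>y\<in>Fp. gauss y) = gauss 0 + (\<Sum>y\<in>Fp_units. gauss y)"
    unfolding Fp_units_def by (simp add: sum.remove[of Fp 0])
  moreover have "gauss 0 = of_nat p" unfolding gauss_def by (simp add: card_Fp)
  ultimately show ?thesis by simp
qed

lemma gauss_nonsquare: assumes "t \<in> Fp_units - Fp_squares" shows "gauss t = - gauss 1"
proof -
  obtain \<nu> where nu: "\<nu> \<in> Fp_units - Fp_squares" using Fp_nonsquare_exists by blast
  have gauss_nu: "gauss y = gauss \<nu>" if "y \<in> Fp_units - Fp_squares" for y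
  proof -
    have "y \<in> (\<lambda>x. \<nu> * x) ` Fp_squares" using that Fp_nonsquares_eq_coset[OF nu] by simp
    then obtain x where x: "x \<in> Fp_squares" "y = \<nu> * x" by (elim imageE)
    then obtain b where "b \<in> Fp" "b ^ 2 = x" "b \<noteq> 0" unfolding Fp_squares_def Fp_units_def by auto
    thus ?thesis using x gauss_mult_square[of \<nu> b] nu unfolding Fp_units_def by simp
  qed
  have "0 = (\<Sum>y\<in>Fp_squares. gauss y) + (\<Sum>y\<in>Fp_units - Fp_squares. gauss y)"
    using sum_gauss Fp_squares_subset by (metis add.commute finite sum.subset_diff)
  also have "\<dots> = of_nat (card Fp_squares) * gauss 1 + of_nat (card (Fp_units - Fp_squares)) * gauss \<nu>"
    using gauss_square gauss_nu by simp
  finally have "of_nat (card Fp_squares) * (gauss 1 + gauss \<nu>) = 0"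
    unfolding card_Fp_nonsquares by (simp add: algebra_simps)
  moreover have "card Fp_squares \<noteq> 0" using card_Fp_squares p_ge3 by auto
  ultimately have "gauss \<nu> = - gauss 1" by (simp add: eq_neg_iff_add_eq_0 add.commute)
  thus ?thesis using gauss_nu[OF assms] by simp
qed

lemma gauss_eq_eta: "a \<in> Fp_units \<Longrightarrow> gauss a = eta a * gauss 1"
  unfolding eta_def using gauss_square gauss_nonsquare by auto

lemma gauss_mult: "y \<in> Fp_units \<Longrightarrow> a \<in> Fp_units \<Longrightarrow> gauss (y * a) = eta y * gauss a"
  using gauss_eq_eta eta_mult Fp_units_mult by (simp add: mult_ac)

lemma prod_gauss_mult:
  "set as \<subseteq> Fp_units \<Longrightarrow> y \<in> Fp_units \<Longrightarrow>
    (\<Prod>a\<leftarrow>as. gauss (y * a)) = eta y ^ length as * (\<Prod>a\<leftarrow>as. gauss a)"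
  by (induction as) (simp_all add: gauss_mult)

lemma gauss_1_mult_gauss_minus_1: "gauss 1 * gauss (-1) = of_nat p"
proof -
  have "gauss 1 * gauss (-1) = (\<Sum>(s, t)\<in>Fp \<times> Fp. psi ((s + t) * (s - t)))"
  proof -
    have "psi (s ^ 2) * psi (- 1 * t ^ 2) = psi ((s + t) * (s - t))" if "s \<in> Fp" "t \<in> Fp" for s t
    proof -
      have "psi (s ^ 2) * psi (- 1 * t ^ 2) = psi (s ^ 2 + - (t ^ 2))"
        using psi_add[of "s ^ 2" "- (t ^ 2)"] that by (simp add: Fp_power Fp_uminus)
      also have "s ^ 2 + - (t ^ 2) = (s + t) * (s - t)" by (simp add: algebra_simps power2_eq_square)
      finally show ?thesis .
    qed
    thus ?thesis unfolding gauss_def sum_product sum.cartesian_product by (intro sum.cong) auto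
  qed
  also have "\<dots> = (\<Sum>(u, v)\<in>Fp \<times> Fp. psi (u * v))"
    using sum.reindex_bij_betw[OF bij_betw_sum_diff[OF two_neq_zero Fp_add Fp_diff], of "\<lambda>(u, v). psi (u * v)"]
    by (simp add: case_prod_unfold Fp_divide)
  also have "\<dots> = (\<Sum>u\<in>Fp. \<Sum>v\<in>Fp. psi (v * u))" by (simp add: sum.cartesian_product mult.commute)
  also have "\<dots> = of_nat p" by (simp add: sum_psi_Fp sum.delta)
  finally show ?thesis .
qed

lemma gauss_1_squared: "gauss 1 ^ 2 = of_nat p \<or> gauss 1 ^ 2 = - of_nat p"
proof (cases "-1 \<in> Fp_squares")
  case True
  hence "gauss (-1) = gauss 1" by (rule gauss_square)
  thus ?thesis using gauss_1_mult_gauss_minus_1 by (simp add: power2_eq_square)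
next
  case False
  hence "gauss (-1) = - gauss 1" by (intro gauss_nonsquare) (simp add: Fp_units_def Fp_uminus)
  hence "- (gauss 1 ^ 2) = of_nat p" using gauss_1_mult_gauss_minus_1 by (simp add: power2_eq_square)
  thus ?thesis by (simp add: minus_equation_iff)
qed

lemma prod_gauss_even_length:
  assumes as: "set as \<subseteq> Fp_units" and even: "even (length as)"
  shows "(\<Prod>a\<leftarrow>as. gauss a) = of_nat p ^ (length as div 2) \<or>
         (\<Prod>a\<leftarrow>as. gauss a) = - (of_nat p ^ (length as div 2))"
proof -
  define e where "e = (\<Prod>a\<leftarrow>as. eta a)"
  have e: "e = 1 \<or> e = -1" unfolding e_def by (induction as) (auto simp: eta_def)
  have "(\<Prod>a\<leftarrow>as. gauss a) = e * gauss 1 ^ length as"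
    unfolding e_def using as
  proof (induction as)
    case (Cons a as)
    thus ?case using gauss_eq_eta[of a] by simp
  qed simp
  also have "gauss 1 ^ length as = (gauss 1 ^ 2) ^ (length as div 2)"
    using even by (simp add: power_mult[symmetric])
  finally have prod: "(\<Prod>a\<leftarrow>as. gauss a) = e * (gauss 1 ^ 2) ^ (length as div 2)" .
  have "(gauss 1 ^ 2) ^ j = of_nat p ^ j \<or> (gauss 1 ^ 2) ^ j = - (of_nat p ^ j)" for j
  proof (cases "gauss 1 ^ 2 = of_nat p")
    case False
    hence "gauss 1 ^ 2 = - of_nat p" using gauss_1_squared by blast
    thus ?thesis by (cases "even j") simp_all
  qed simp
  from this[of "length as div 2"] e show ?thesis unfolding prod by auto
qed

subsection \<open>Quadratic forms over the prime field\<close>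

definition Fp_subspace :: "'a set \<Rightarrow> bool" where
  "Fp_subspace W \<longleftrightarrow> 0 \<in> W \<and> (\<forall>x\<in>W. \<forall>z\<in>W. x + z \<in> W) \<and> (\<forall>s\<in>Fp. \<forall>x\<in>W. s * x \<in> W)"

lemma Fp_subspace_UNIV: "Fp_subspace UNIV" unfolding Fp_subspace_def by auto

end

locale Fp_quadratic_form = galois_field p m ty for p m and ty :: "'a::{field,finite} itself" +
  fixes Q :: "'a \<Rightarrow> 'a"
  assumes Q_in_Fp: "Q x \<in> Fp"
    and Q_Fp_mult: "s \<in> Fp \<Longrightarrow> Q (s * x) = s ^ 2 * Q x"
    and Q_polar_additive: "Q ((x + y) + z) - Q (x + y) - Q z = (Q (x + z) - Q x - Q z) + (Q (y + z) - Q y - Q z)"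
begin

definition polar :: "'a \<Rightarrow> 'a \<Rightarrow> 'a" where "polar x z = Q (x + z) - Q x - Q z"

definition radical :: "'a set \<Rightarrow> 'a set" where "radical W = {x\<in>W. \<forall>z\<in>W. polar x z = 0}"

lemma polar_add_left: "polar (x + y) z = polar x z + polar y z"
  unfolding polar_def by (rule Q_polar_additive)

lemma polar_commute: "polar x z = polar z x"
  unfolding polar_def by (simp add: add.commute algebra_simps)

lemma polar_add_right: "polar z (x + y) = polar z x + polar z y"
  using polar_add_left polar_commute by metis

lemma Q_0[simp]: "Q 0 = 0"
  using Q_Fp_mult[of 0 0] by simp

lemma polar_0_left [simp]: "polar 0 z = 0" and polar_0_right [simp]: "polar z 0 = 0"
  unfolding polar_def by simp_all

lemma polar_of_nat_left: "polar (of_nat n * x) z = of_nat n * polar x z"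
proof (induction n)
  case (Suc n)
  have "polar (of_nat (Suc n) * x) z = polar (of_nat n * x + x) z" by (simp add: algebra_simps)
  also have "\<dots> = of_nat n * polar x z + polar x z" by (simp add: polar_add_left Suc)
  finally show ?case by (simp add: algebra_simps)
qed simp

lemma polar_Fp_mult_left: "s \<in> Fp \<Longrightarrow> polar (s * x) z = s * polar x z"
  unfolding Fp_def using polar_of_nat_left by auto

lemma polar_Fp_mult_right: "s \<in> Fp \<Longrightarrow> polar z (s * x) = s * polar z x"
  using polar_Fp_mult_left polar_commute by metis

lemma polar_in_Fp: "polar x z \<in> Fp" unfolding polar_def using Q_in_Fp Fp_diff by simp

lemma polar_self: "polar x x = 2 * Q x"
proof -
  have "Q (x + x) = Q (2 * x)" by simp
  also have "\<dots> = 4 * Q x" using Q_Fp_mult[of 2 x] by simp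
  finally show ?thesis unfolding polar_def by simp
qed

lemma Q_add: "Q (x + z) = Q x + Q z + polar x z" unfolding polar_def by simp

definition orth :: "'a \<Rightarrow> 'a set \<Rightarrow> 'a set" where "orth v W = {w\<in>W. polar v w = 0}"

lemma Fp_subspace_orth: "Fp_subspace W \<Longrightarrow> Fp_subspace (orth v W)"
  unfolding Fp_subspace_def orth_def by (auto simp: polar_add_right polar_Fp_mult_right)

text \<open>Splitting off an anisotropic vector: \<open>x \<mapsto> (polar v x / polar v v, x - \<dots>)\<close> inverts the map below.\<close>
lemma bij_betw_orth_decomp:
  assumes W: "Fp_subspace W" and v: "v \<in> W" "Q v \<noteq> 0"
  shows "bij_betw (\<lambda>(s, w). s * v + w) (Fp \<times> orth v W) W"
proof -
  have Wadd: "\<And>x z. x \<in> W \<Longrightarrow> z \<in> W \<Longrightarrow> x + z \<in> W"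
    and Wmult: "\<And>s x. s \<in> Fp \<Longrightarrow> x \<in> W \<Longrightarrow> s * x \<in> W" using W unfolding Fp_subspace_def by auto
  define c where "c = polar v v"
  have c: "c \<noteq> 0" "c \<in> Fp"
    unfolding c_def using v(2) two_neq_zero by (simp_all add: polar_self Fp_mult Q_in_Fp)
  have polar_comb: "polar v (s * v + w) = s * c + polar v w" if "s \<in> Fp" for s w
    unfolding c_def using that by (simp add: polar_add_right polar_Fp_mult_right)
  show ?thesis
  proof (rule bij_betwI[where g = "\<lambda>x. (polar v x / c, x - (polar v x / c) * v)"])
    show "(\<lambda>(s, w). s * v + w) \<in> Fp \<times> orth v W \<rightarrow> W" unfolding orth_def using Wadd Wmult v by auto
    show "(\<lambda>x. (polar v x / c, x - (polar v x / c) * v)) \<in> W \<rightarrow> Fp \<times> orth v W"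
    proof
      fix x assume x: "x \<in> W"
      define s where "s = polar v x / c"
      have s: "s \<in> Fp" "- s \<in> Fp" unfolding s_def using polar_in_Fp c by (simp_all add: Fp_divide Fp_uminus)
      have "polar v (- s * v + x) = 0" using polar_comb[OF s(2)] c unfolding s_def by simp
      moreover have "- s * v + x \<in> W" using Wadd Wmult x v s by blast
      ultimately show "(s, x - s * v) \<in> Fp \<times> orth v W" unfolding orth_def using s by simp
    qed
    show "(\<lambda>x. (polar v x / c, x - (polar v x / c) * v)) ((\<lambda>(s, w). s * v + w) sw) = sw"
      if "sw \<in> Fp \<times> orth v W" for sw
      using that polar_comb c unfolding orth_def by auto
  qed auto
qed

lemma radical_orth:
  assumes W: "Fp_subspace W" and v: "v \<in> W" "Q v \<noteq> 0"
  shows "radical (orth v W) = radical W"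
proof
  show "radical W \<subseteq> radical (orth v W)"
    unfolding radical_def orth_def using v(1) polar_commute by fastforce
  show "radical (orth v W) \<subseteq> radical W"
  proof
    fix x assume x: "x \<in> radical (orth v W)"
    have "polar x z = 0" if "z \<in> W" for z
    proof -
      obtain s w where s: "s \<in> Fp" and w: "w \<in> orth v W" and z: "z = s * v + w"
        using bij_betw_imp_surj_on[OF bij_betw_orth_decomp[OF assms]] \<open>z \<in> W\<close> by force
      have "polar x z = s * polar v x + polar x w"
        unfolding z using s by (simp add: polar_add_right polar_Fp_mult_right polar_commute)
      thus ?thesis using x w unfolding radical_def orth_def by simp
    qed
    thus "x \<in> radical W" using x unfolding radical_def orth_def by auto
  qed
qed

lemma sum_psi_Q_orth:
  assumes W: "Fp_subspace W" and v: "v \<in> W" "Q v \<noteq> 0" and y: "y \<in> Fp"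
  shows "(\<Sum>x\<in>W. psi (y * Q x)) = gauss (y * Q v) * (\<Sum>x\<in>orth v W. psi (y * Q x))"
proof -
  have "(\<Sum>x\<in>W. psi (y * Q x)) = (\<Sum>(s, w)\<in>Fp \<times> orth v W. psi (y * Q (s * v + w)))"
    using sum.reindex_bij_betw[OF bij_betw_orth_decomp[OF W v], of "\<lambda>x. psi (y * Q x)"]
    by (simp add: case_prod_unfold)
  also have "\<dots> = (\<Sum>(s, w)\<in>Fp \<times> orth v W. psi (y * Q v * s ^ 2) * psi (y * Q w))"
  proof (intro sum.cong refl, clarify)
    fix s w assume s: "s \<in> Fp" and w: "w \<in> orth v W"
    have "Q (s * v + w) = s ^ 2 * Q v + Q w"
      using w Q_add[of "s * v" w] Q_Fp_mult[OF s] polar_Fp_mult_left[OF s] unfolding orth_def by simp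
    hence "y * Q (s * v + w) = y * Q v * s ^ 2 + y * Q w" by (simp add: algebra_simps)
    thus "psi (y * Q (s * v + w)) = psi (y * Q v * s ^ 2) * psi (y * Q w)"
      using psi_add y s Q_in_Fp by (simp add: Fp_mult Fp_power)
  qed
  also have "\<dots> = (\<Sum>s\<in>Fp. \<Sum>w\<in>orth v W. psi (y * Q v * s ^ 2) * psi (y * Q w))"
    by (rule sum.cartesian_product[symmetric])
  also have "\<dots> = gauss (y * Q v) * (\<Sum>x\<in>orth v W. psi (y * Q x))"
    by (simp only: gauss_def sum_distrib_right) (simp only: sum_distrib_left)
  finally show ?thesis .
qed

text \<open>Diagonalisation of \<open>Q\<close> on \<open>W\<close>: the list \<open>as\<close> holds the diagonal coefficients of a
  nondegenerate complement of the radical.\<close>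
lemma form_character_sum_diagonal:
  assumes "Fp_subspace W"
  shows "\<exists>as. set as \<subseteq> Fp_units \<and> card W = card (radical W) * p ^ length as \<and>
     (\<forall>y\<in>Fp. (\<Sum>x\<in>W. psi (y * Q x)) = of_nat (card (radical W)) * (\<Prod>a\<leftarrow>as. gauss (y * a)))"
  using assms
proof (induction "card W" arbitrary: W rule: less_induct)
  case less
  show ?case
  proof (cases "\<forall>x\<in>W. Q x = 0")
    case True
    hence "radical W = W"
      using less.prems unfolding radical_def polar_def Fp_subspace_def by auto
    thus ?thesis using True by (intro exI[of _ "[]"]) simp
  next
    case False
    then obtain v where v: "v \<in> W" "Q v \<noteq> 0" by blast
    have "v \<notin> orth v W" using v(2) two_neq_zero polar_self unfolding orth_def by simp
    hence "card (orth v W) < card W" using v(1) unfolding orth_def by (intro psubset_card_mono) auto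
    then obtain as where as: "set as \<subseteq> Fp_units"
      "card (orth v W) = card (radical (orth v W)) * p ^ length as"
      "\<forall>y\<in>Fp. (\<Sum>x\<in>orth v W. psi (y * Q x)) = of_nat (card (radical (orth v W))) * (\<Prod>a\<leftarrow>as. gauss (y * a))"
      using less.hyps Fp_subspace_orth[OF less.prems] by blast
    have "card W = p * card (orth v W)"
      using bij_betw_same_card[OF bij_betw_orth_decomp[OF less.prems v]] card_Fp
      by (simp add: card_cartesian_product)
    moreover have "Q v \<in> Fp_units" using v Q_in_Fp unfolding Fp_units_def by simp
    ultimately show ?thesis
      using as radical_orth[OF less.prems v] sum_psi_Q_orth[OF less.prems v]
      by (intro exI[of _ "Q v # as"]) auto
  qed
qed

definition form_sum :: complex where "form_sum = (\<Sum>y\<in>Fp_units. \<Sum>x\<in>UNIV. psi (y * Q x))"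

lemma form_sum_values_rank:
  "\<exists>n. card (UNIV::'a set) = card (radical UNIV) * p ^ n \<and> (odd n \<longrightarrow> form_sum = 0) \<and>
     (even n \<longrightarrow> form_sum = of_nat (p - 1) * of_nat (card (radical UNIV)) * of_nat p ^ (n div 2) \<or>
                 form_sum = - (of_nat (p - 1) * of_nat (card (radical UNIV)) * of_nat p ^ (n div 2)))"
proof -
  obtain as where as: "set as \<subseteq> Fp_units" "card (UNIV::'a set) = card (radical UNIV) * p ^ length as"
    "\<forall>y\<in>Fp. (\<Sum>x\<in>UNIV. psi (y * Q x)) = of_nat (card (radical UNIV)) * (\<Prod>a\<leftarrow>as. gauss (y * a))"
    using form_character_sum_diagonal[OF Fp_subspace_UNIV] by blast
  define R :: complex where "R = of_nat (card (radical UNIV))"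
  define n where "n = length as"
  have "form_sum = (\<Sum>y\<in>Fp_units. R * (eta y ^ n * (\<Prod>a\<leftarrow>as. gauss a)))"
    unfolding form_sum_def R_def n_def
    by (rule sum.cong) (use as(3) prod_gauss_mult[OF as(1)] Fp_units_in_Fp in auto)
  also have "\<dots> = R * (\<Prod>a\<leftarrow>as. gauss a) * (if even n then of_nat (p - 1) else 0)"
    by (simp add: sum_distrib_left[symmetric] sum_distrib_right[symmetric] sum_eta_power mult.assoc)
  finally have T: "form_sum = R * (\<Prod>a\<leftarrow>as. gauss a) * (if even n then of_nat (p - 1) else 0)" .
  show ?thesis
  proof (intro exI[of _ n] conjI impI)
    show "card (UNIV::'a set) = card (radical UNIV) * p ^ n" using as(2) n_def by simp
    show "form_sum = 0" if "odd n" using T that by simp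
    assume "even n"
    thus "form_sum = of_nat (p - 1) * of_nat (card (radical UNIV)) * of_nat p ^ (n div 2) \<or>
          form_sum = - (of_nat (p - 1) * of_nat (card (radical UNIV)) * of_nat p ^ (n div 2))"
      using T prod_gauss_even_length[OF as(1)] unfolding R_def n_def by auto
  qed
qed

text \<open>In terms of \<open>p ^ r = card (radical UNIV)\<close>: \<open>m - r\<close> is the rank of \<open>Q\<close>, and summing
  over the scalars \<open>y\<close> kills the odd-rank case.\<close>
lemma form_sum_values:
  obtains r where "r \<le> m" "card (radical UNIV) = p ^ r" "odd (m - r) \<Longrightarrow> form_sum = 0"
    "even (m - r) \<Longrightarrow> form_sum = of_nat (p - 1) * of_nat p ^ r * of_nat p ^ ((m - r) div 2) \<or>
                      form_sum = - (of_nat (p - 1) * of_nat p ^ r * of_nat p ^ ((m - r) div 2))"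
proof -
  obtain n where n: "card (UNIV::'a set) = card (radical UNIV) * p ^ n" "odd n \<longrightarrow> form_sum = 0"
    "even n \<longrightarrow> form_sum = of_nat (p - 1) * of_nat (card (radical UNIV)) * of_nat p ^ (n div 2) \<or>
                 form_sum = - (of_nat (p - 1) * of_nat (card (radical UNIV)) * of_nat p ^ (n div 2))"
    using form_sum_values_rank by blast
  have "card (radical UNIV) > 0" using n(1) by (metis card_UNIV_pos gr0I mult_is_0)
  hence "p ^ n \<le> p ^ m" using n(1) card_UNIV by (metis le_add2 mult_le_cancel2 nat_mult_1 neq0_conv One_nat_def Suc_leI)
  hence nm: "n \<le> m" by (rule power_le_imp_le_exp[OF p_gt1])
  hence "card (radical UNIV) * p ^ n = p ^ (m - n) * p ^ n" using n(1) card_UNIV by (simp flip: power_add)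
  hence "card (radical UNIV) = p ^ (m - n)" using p_gt1 by simp
  moreover have "m - (m - n) = n" using nm by simp
  ultimately show ?thesis using that[of "m - n"] n by simp
qed

end

subsection \<open>The quadratic forms \<open>Tr (u x^2 + c x^(p^k+1))\<close>\<close>

locale trace_form_family = galois_field p m ty for p m and ty :: "'a::{field,finite} itself" +
  fixes k :: nat
begin

definition trace_form :: "'a \<Rightarrow> 'a \<Rightarrow> 'a \<Rightarrow> 'a" where "trace_form u c x = Tr (u * x ^ 2 + c * x ^ (p ^ k + 1))"

lemma power_frobenius_plus_1: "(x::'a) ^ (p ^ k + 1) = x ^ (p ^ k) * x" by simp

lemma trace_form_polar: "trace_form u c (x + z) - trace_form u c x - trace_form u c z = Tr (2 * u * x * z + c * (x ^ (p ^ k) * z + x * z ^ (p ^ k)))"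
proof -
  have "u * (x + z) ^ 2 + c * (x + z) ^ (p ^ k + 1) - (u * x ^ 2 + c * x ^ (p ^ k + 1)) - (u * z ^ 2 + c * z ^ (p ^ k + 1))
      = 2 * u * x * z + c * (x ^ (p ^ k) * z + x * z ^ (p ^ k))"
    unfolding power_frobenius_plus_1 frobenius_add by (simp add: algebra_simps power2_eq_square)
  thus ?thesis unfolding trace_form_def by (simp add: tr_diff[symmetric])
qed

lemma Fp_quadratic_form_trace_form: "Fp_quadratic_form p m (trace_form u c)"
proof (unfold_locales)
  fix x show "trace_form u c x \<in> Fp" unfolding trace_form_def by (rule tr_in_Fp)
next
  fix s x :: 'a assume s: "s \<in> Fp"
  have "(s * x) ^ (p ^ k + 1) = s ^ 2 * x ^ (p ^ k + 1)"
    unfolding power_frobenius_plus_1 using Fp_power_p_power[OF s] by (simp add: power_mult_distrib power2_eq_square mult_ac)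
  hence "u * (s * x) ^ 2 + c * (s * x) ^ (p ^ k + 1) = s ^ 2 * (u * x ^ 2 + c * x ^ (p ^ k + 1))"
    by (simp add: power_mult_distrib algebra_simps)
  thus "trace_form u c (s * x) = s ^ 2 * trace_form u c x" unfolding trace_form_def using tr_Fp_mult Fp_power s by simp
next
  fix x y z :: 'a
  show "trace_form u c (x + y + z) - trace_form u c (x + y) - trace_form u c z =
        trace_form u c (x + z) - trace_form u c x - trace_form u c z + (trace_form u c (y + z) - trace_form u c y - trace_form u c z)"
    unfolding trace_form_polar tr_add[symmetric] frobenius_add by (simp add: algebra_simps)
qed

definition lin_poly :: "'a \<Rightarrow> 'a \<Rightarrow> 'a \<Rightarrow> 'a" where
  "lin_poly u c x = c ^ (p ^ k) * x ^ (p ^ (2 * k)) + (2 * u) ^ (p ^ k) * x ^ (p ^ k) + c * x"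

lemma polar_trace_form: "Fp_quadratic_form.polar (trace_form u c) x z = Tr (z ^ (p ^ k) * lin_poly u c x)"
proof -
  have "Fp_quadratic_form.polar (trace_form u c) x z = Tr (2 * u * x * z + c * (x ^ (p ^ k) * z + x * z ^ (p ^ k)))"
    unfolding Fp_quadratic_form.polar_def[OF Fp_quadratic_form_trace_form] trace_form_polar ..
  also have "\<dots> = Tr (z * (2 * u * x + c * x ^ (p ^ k))) + Tr (z ^ (p ^ k) * (c * x))"
    unfolding tr_add[symmetric] by (simp add: algebra_simps)
  also have "Tr (z * (2 * u * x + c * x ^ (p ^ k))) = Tr ((z * (2 * u * x + c * x ^ (p ^ k))) ^ (p ^ k))"
    by (rule tr_frobenius[symmetric])
  also have "(z * (2 * u * x + c * x ^ (p ^ k))) ^ (p ^ k)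
      = z ^ (p ^ k) * ((2 * u) ^ (p ^ k) * x ^ (p ^ k) + c ^ (p ^ k) * x ^ (p ^ (2 * k)))"
  proof -
    have "(x ^ (p ^ k)) ^ (p ^ k) = x ^ (p ^ (2 * k))" by (simp add: power_mult[symmetric] power_add[symmetric] mult_2)
    thus ?thesis by (simp add: power_mult_distrib frobenius_add mult.assoc)
  qed
  finally show ?thesis unfolding lin_poly_def tr_add[symmetric] by (simp add: algebra_simps)
qed

lemma radical_trace_form_subset: "Fp_quadratic_form.radical (trace_form u c) UNIV \<subseteq> {x. lin_poly u c x = 0}"
proof
  fix x assume "x \<in> Fp_quadratic_form.radical (trace_form u c) UNIV"
  hence h: "\<forall>z. Tr (z ^ (p ^ k) * lin_poly u c x) = 0"
    unfolding Fp_quadratic_form.radical_def[OF Fp_quadratic_form_trace_form] polar_trace_form by auto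
  have "\<forall>w. Tr (lin_poly u c x * w) = 0"
  proof
    fix w :: 'a
    obtain z where "z ^ (p ^ k) = w" using frobenius_surj[of k w] by (elim exE)
    thus "Tr (lin_poly u c x * w) = 0" using h by (metis mult.commute)
  qed
  thus "x \<in> {x. lin_poly u c x = 0}" using tr_nondegenerate by auto
qed

definition T :: "'a \<Rightarrow> 'a \<Rightarrow> complex" where
  "T u c = (\<Sum>y\<in>Fp_units. \<Sum>x\<in>UNIV. psi (y * trace_form u c x))"

lemma T_eq_form_sum: "T u c = Fp_quadratic_form.form_sum p (trace_form u c)"
  unfolding T_def Fp_quadratic_form.form_sum_def[OF Fp_quadratic_form_trace_form] ..

lemma T_0_0: "T 0 0 = of_nat (p - 1) * of_nat (p ^ m)"
  unfolding T_def trace_form_def using card_Fp_units card_UNIV by simp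

lemma lin_poly_roots_c_0: "u \<noteq> 0 \<Longrightarrow> {x. lin_poly u 0 x = 0} = {0}"
proof -
  assume u: "u \<noteq> 0"
  have "2 * u \<noteq> 0" using u two_neq_zero by simp
  have "p ^ k \<noteq> 0" using p_gt1 by simp
  hence "lin_poly u 0 x = 0 \<longleftrightarrow> x = 0" for x
    unfolding lin_poly_def using \<open>2 * u \<noteq> 0\<close> p_gt1 by (simp add: power_0_left)
  thus ?thesis by auto
qed

lemma psi_tr_add: "psi (Tr a) * psi (Tr b) = psi (Tr (a + b))"
  using psi_add[OF tr_in_Fp tr_in_Fp, of a b] tr_add by simp

lemma psi_trace_form: assumes "y \<in> Fp"
  shows "psi (y * trace_form u c x) = psi (Tr ((y * x ^ 2) * u)) * psi (Tr (y * c * x ^ (p ^ k + 1)))"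
proof -
  have "y * trace_form u c x = Tr ((y * x ^ 2) * u) + Tr (y * c * x ^ (p ^ k + 1))"
    unfolding trace_form_def tr_Fp_mult[OF assms, symmetric] tr_add[symmetric] by (simp add: algebra_simps)
  thus ?thesis using psi_add tr_in_Fp by simp
qed

lemma psi_trace_form_pair: assumes "y \<in> Fp" "y' \<in> Fp"
  shows "psi (y * trace_form u c x) * psi (y' * trace_form u c x') =
     psi (Tr ((y * x ^ 2 + y' * x' ^ 2) * u)) * psi (Tr (c * (y * x ^ (p ^ k + 1) + y' * x' ^ (p ^ k + 1))))"
proof -
  have "psi (y * trace_form u c x) * psi (y' * trace_form u c x') =
     (psi (Tr ((y * x ^ 2) * u)) * psi (Tr ((y' * x' ^ 2) * u))) *
     (psi (Tr (y * c * x ^ (p ^ k + 1))) * psi (Tr (y' * c * x' ^ (p ^ k + 1))))"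
    unfolding psi_trace_form[OF assms(1)] psi_trace_form[OF assms(2)] by (simp add: mult_ac)
  also have "\<dots> = psi (Tr ((y * x ^ 2 + y' * x' ^ 2) * u)) * psi (Tr (c * (y * x ^ (p ^ k + 1) + y' * x' ^ (p ^ k + 1))))"
    unfolding psi_tr_add by (simp add: algebra_simps)
  finally show ?thesis .
qed

lemma sum_psi_trace_form:
  assumes "y \<in> Fp_units"
  shows "(\<Sum>u\<in>UNIV. psi (y * trace_form u c x)) = (if x = 0 then of_nat (p ^ m) else 0)"
proof -
  have "(\<Sum>u\<in>UNIV. psi (y * trace_form u c x)) =
      (\<Sum>u\<in>UNIV. psi (Tr ((y * x ^ 2) * u))) * psi (Tr (y * c * x ^ (p ^ k + 1)))"
    using psi_trace_form[OF Fp_units_in_Fp[OF assms]] by (simp add: sum_distrib_right)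
  thus ?thesis using Fp_units_neq_0[OF assms] card_UNIV by (simp add: sum_psi_tr)
qed

lemma sum_T: "(\<Sum>u\<in>UNIV. T u c) = of_nat (p - 1) * of_nat (p ^ m)"
proof -
  have "(\<Sum>u\<in>UNIV. T u c) = (\<Sum>y\<in>Fp_units. \<Sum>x\<in>UNIV. \<Sum>u\<in>UNIV. psi (y * trace_form u c x))"
    unfolding T_def by (rule sum_swap_innermost)
  also have "\<dots> = (\<Sum>y\<in>Fp_units. of_nat (p ^ m))" by (simp add: sum_psi_trace_form)
  finally show ?thesis using card_Fp_units by simp
qed

lemma T_Fp_unit_mult: assumes lam: "lam \<in> Fp_units"
  shows "(\<Sum>y\<in>Fp_units. \<Sum>x\<in>UNIV. psi (y * (lam * trace_form u c x))) = T u c"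
proof -
  have bij: "bij_betw (\<lambda>y. y * lam) Fp_units Fp_units"
    by (rule bij_betwI[where g = "\<lambda>y. y / lam"])
       (use lam in \<open>auto simp: Fp_units_def Fp_mult Fp_divide\<close>)
  have "T u c = (\<Sum>y\<in>Fp_units. \<Sum>x\<in>UNIV. psi ((y * lam) * trace_form u c x))"
    unfolding T_def using sum.reindex_bij_betw[OF bij, of "\<lambda>y. \<Sum>x\<in>UNIV. psi (y * trace_form u c x)"] by simp
  thus ?thesis by (simp add: mult.assoc)
qed

lemma S_eq_T_sum: assumes lam: "lam \<in> Fp_units"
  shows "S p m k lam a b c = T (a + b) c + T (a - b) c"
proof -
  have "S p m k lam a b c =
    (\<Sum>y\<in>{1..<p}. \<Sum>x\<in>UNIV. psi (of_nat y * trace_form (a + b) c x) + psi (of_nat y * (lam * trace_form (a - b) c x)))"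
  proof -
    have e2: "tr p m ((a - b) * lam * x ^ 2 + c * lam * x ^ (p ^ k + 1)) = lam * trace_form (a - b) c x" for x
    proof -
      have "(a - b) * lam * x ^ 2 + c * lam * x ^ (p ^ k + 1) = lam * ((a - b) * x ^ 2 + c * x ^ (p ^ k + 1))"
        by (simp add: algebra_simps)
      thus ?thesis unfolding trace_form_def using tr_Fp_mult[OF Fp_units_in_Fp[OF lam]] by simp
    qed
    have inner: "zeta p ^ (y * fp_val p (tr p m ((a + b) * x ^ 2 + c * x ^ (p ^ k + 1)))) +
        zeta p ^ (y * fp_val p (tr p m ((a - b) * lam * x ^ 2 + c * lam * x ^ (p ^ k + 1)))) =
        psi (of_nat y * trace_form (a + b) c x) + psi (of_nat y * (lam * trace_form (a - b) c x))" for y x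
    proof -
      have e1: "tr p m ((a + b) * x ^ 2 + c * x ^ (p ^ k + 1)) = trace_form (a + b) c x" unfolding trace_form_def ..
      have q1: "trace_form (a + b) c x \<in> Fp" unfolding trace_form_def by (rule tr_in_Fp)
      have q2: "lam * trace_form (a - b) c x \<in> Fp" using Fp_mult Fp_units_in_Fp[OF lam] tr_in_Fp unfolding trace_form_def by blast
      show ?thesis unfolding e1 e2 zeta_power_fp_val[OF q1] zeta_power_fp_val[OF q2] ..
    qed
    show ?thesis unfolding S_def inner ..
  qed
  also have "\<dots> = (\<Sum>y\<in>Fp_units. \<Sum>x\<in>UNIV. psi (y * trace_form (a + b) c x) + psi (y * (lam * trace_form (a - b) c x)))"
    by (rule sum_Fp_units_of_nat)
  also have "\<dots> = T (a + b) c + (\<Sum>y\<in>Fp_units. \<Sum>x\<in>UNIV. psi (y * (lam * trace_form (a - b) c x)))"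
    unfolding T_def by (simp add: sum.distrib)
  also have "\<dots> = T (a + b) c + T (a - b) c" using T_Fp_unit_mult[OF lam] by simp
  finally show ?thesis .
qed

end

locale trace_form_setting = trace_form_family p m ty k for p m and ty :: "'a::{field,finite} itself" and k +
  assumes odd_m: "odd m" and m_ge_3: "m \<ge> 3" and coprime_m_k: "coprime m k"
begin

lemma Fp_if_frobenius_k_fixed: "(x::'a) ^ (p ^ k) = x \<Longrightarrow> x \<in> Fp"
  using Fp_if_frobenius_fixed coprime_m_k by (simp add: coprime_commute)

lemma card_binomial_roots:
  fixes A B :: 'a
  assumes A: "A \<noteq> 0"
  shows "card {w. A * w ^ (p ^ k) + B * w = 0} \<le> p"
proof (cases "\<exists>w0. w0 \<noteq> 0 \<and> A * w0 ^ (p ^ k) + B * w0 = 0")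
  case False
  hence "{w. A * w ^ (p ^ k) + B * w = 0} \<subseteq> {0}" by auto
  hence "card {w. A * w ^ (p ^ k) + B * w = 0} \<le> card {0::'a}" by (intro card_mono) simp_all
  thus ?thesis using p_gt1 by simp
next
  case True
  then obtain w0 where w0: "w0 \<noteq> 0" "A * w0 ^ (p ^ k) + B * w0 = 0" by blast
  have w0s: "w0 ^ (p ^ k) \<noteq> 0" using w0 by simp
  have "{w. A * w ^ (p ^ k) + B * w = 0} \<subseteq> (\<lambda>s. s * w0) ` Fp"
  proof
    fix w assume "w \<in> {w. A * w ^ (p ^ k) + B * w = 0}"
    hence w: "A * w ^ (p ^ k) + B * w = 0" by simp
    have Aw: "A * w ^ (p ^ k) = - (B * w)" "A * w0 ^ (p ^ k) = - (B * w0)"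
      using w w0(2) by (simp_all add: eq_neg_iff_add_eq_0)
    have "A * (w ^ (p ^ k) * w0) = (A * w ^ (p ^ k)) * w0" by (simp add: mult.assoc)
    also have "\<dots> = w * (A * w0 ^ (p ^ k))" unfolding Aw by (simp add: algebra_simps)
    also have "\<dots> = A * (w * w0 ^ (p ^ k))" by (simp add: mult_ac)
    finally have "A * (w ^ (p ^ k) * w0) = A * (w * w0 ^ (p ^ k))" .
    hence e: "w ^ (p ^ k) * w0 = w * w0 ^ (p ^ k)" using A by simp
    have "(w / w0) ^ (p ^ k) = w / w0"
      using e w0 w0s by (simp add: power_divide field_simps)
    hence "w / w0 \<in> Fp" by (rule Fp_if_frobenius_k_fixed)
    moreover have "w = (w / w0) * w0" using w0 by simp
    ultimately show "w \<in> (\<lambda>s. s * w0) ` Fp" by blast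
  qed
  hence "card {w. A * w ^ (p ^ k) + B * w = 0} \<le> card ((\<lambda>s. s * w0) ` Fp)" by (simp add: card_mono)
  also have "\<dots> \<le> card Fp" by (rule card_image_le) simp
  finally show ?thesis using card_Fp by simp
qed

text \<open>A nonzero root \<open>x1\<close> turns the equation \<open>lin_poly u c x = 0\<close> into the two-term equation
  \<open>A * w ^ (p ^ k) + B * w = 0\<close> in \<open>w = y ^ (p ^ k) - y\<close>, where \<open>y = x / x1\<close>.\<close>
lemma lin_poly_root_reduction:
  assumes c: "c \<noteq> 0" and x1: "lin_poly u c x1 = 0" and x: "lin_poly u c x = 0"
  defines "A \<equiv> c ^ (p ^ k) * x1 ^ (p ^ (2 * k))"
  defines "B \<equiv> A + (2 * u) ^ (p ^ k) * x1 ^ (p ^ k)"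
  assumes x1_ne: "x1 \<noteq> 0"
  shows "A * ((x / x1) ^ (p ^ k) - x / x1) ^ (p ^ k) + B * ((x / x1) ^ (p ^ k) - x / x1) = 0"
proof -
  define a where "a = (2 * u) ^ (p ^ k)"
  define y where "y = x / x1"
  have cx1: "c * x1 = - (A + a * x1 ^ (p ^ k))"
    using x1 unfolding lin_poly_def A_def a_def by (simp add: eq_neg_iff_add_eq_0 algebra_simps)
  have "0 = lin_poly u c (x1 * y)" using x x1_ne unfolding y_def by simp
  also have "\<dots> = A * y ^ (p ^ (2 * k)) + a * x1 ^ (p ^ k) * y ^ (p ^ k) + c * x1 * y"
    unfolding lin_poly_def A_def a_def by (simp add: power_mult_distrib algebra_simps)
  also have "\<dots> = A * (y ^ (p ^ (2 * k)) - y) + a * x1 ^ (p ^ k) * (y ^ (p ^ k) - y)"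
    unfolding cx1 by (simp add: algebra_simps)
  also have "y ^ (p ^ (2 * k)) - y = (y ^ (p ^ k) - y) ^ (p ^ k) + (y ^ (p ^ k) - y)"
    by (simp add: frobenius_diff power_mult[symmetric] power_add[symmetric] mult_2)
  finally show ?thesis unfolding B_def a_def y_def by (simp add: algebra_simps)
qed

lemma card_lin_poly_roots:
  assumes c: "c \<noteq> 0"
  shows "card {x. lin_poly u c x = 0} \<le> p ^ 2"
proof (cases "\<exists>x1. x1 \<noteq> 0 \<and> lin_poly u c x1 = 0")
  case False
  hence "{x. lin_poly u c x = 0} \<subseteq> {0}" by auto
  hence "card {x. lin_poly u c x = 0} \<le> 1" using card_mono[of "{0::'a}"] by fastforce
  thus ?thesis using p_gt1 by (meson le_trans one_le_power less_imp_le)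
next
  case True
  then obtain x1 where x1: "x1 \<noteq> 0" "lin_poly u c x1 = 0" by blast
  define A where "A = c ^ (p ^ k) * x1 ^ (p ^ (2 * k))"
  define B where "B = A + (2 * u) ^ (p ^ k) * x1 ^ (p ^ k)"
  show ?thesis
  proof (rule card_le_p_squared_by_fibres[where f = "\<lambda>x. (x / x1) ^ (p ^ k) - x / x1"
        and E = "{w. A * w ^ (p ^ k) + B * w = 0}" and d = x1])
    show "card {w. A * w ^ (p ^ k) + B * w = 0} \<le> p"
      by (rule card_binomial_roots) (use c x1 in \<open>simp add: A_def\<close>)
    show "(\<lambda>x. (x / x1) ^ (p ^ k) - x / x1) ` {x. lin_poly u c x = 0} \<subseteq> {w. A * w ^ (p ^ k) + B * w = 0}"
      using lin_poly_root_reduction[OF c x1(2) _ x1(1)] unfolding A_def B_def by auto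
    fix x x' assume "(x / x1) ^ (p ^ k) - x / x1 = (x' / x1) ^ (p ^ k) - x' / x1"
    hence "(x' / x1 - x / x1) ^ (p ^ k) = x' / x1 - x / x1"
      unfolding frobenius_diff by (simp add: algebra_simps)
    hence "x' / x1 - x / x1 \<in> Fp" by (rule Fp_if_frobenius_k_fixed)
    moreover have "x' = x + (x' / x1 - x / x1) * x1" using x1 by (simp add: algebra_simps)
    ultimately show "x' \<in> (\<lambda>s. x + s * x1) ` Fp" by blast
  qed
qed

subsection \<open>Values and moments of \<open>T\<close>\<close>

definition H :: real where "H = (real p - 1) * real p ^ ((m + 1) div 2)"

text \<open>For \<open>c = 0\<close> the form is nondegenerate, so its rank \<open>m\<close> is odd.\<close>
lemma T_u_0: assumes "u \<noteq> 0" shows "T u 0 = 0"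
proof -
  interpret Fp_quadratic_form p m ty "trace_form u 0" by (rule Fp_quadratic_form_trace_form)
  obtain r where r: "card (radical UNIV) = p ^ r" "odd (m - r) \<Longrightarrow> form_sum = 0"
    using form_sum_values by metis
  have "card (radical UNIV) \<le> card {x. lin_poly u 0 x = 0}" using radical_trace_form_subset by (simp add: card_mono)
  hence "p ^ r \<le> p ^ 0" using lin_poly_roots_c_0[OF assms] r(1) by simp
  hence "r = 0" using power_le_imp_le_exp[OF p_gt1] by blast
  thus ?thesis using r(2) odd_m T_eq_form_sum by simp
qed

text \<open>For \<open>c \<noteq> 0\<close> the radical has dimension \<open>r \<le> 2\<close>, and \<open>m - r\<close> is even only for \<open>r = 1\<close>.\<close>
lemma T_values: assumes "c \<noteq> 0" shows "T u c \<in> {0, complex_of_real H, - complex_of_real H}"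
proof -
  interpret Fp_quadratic_form p m ty "trace_form u c" by (rule Fp_quadratic_form_trace_form)
  obtain r where r: "r \<le> m" "card (radical UNIV) = p ^ r" "odd (m - r) \<Longrightarrow> form_sum = 0"
    "even (m - r) \<Longrightarrow> form_sum = of_nat (p - 1) * of_nat p ^ r * of_nat p ^ ((m - r) div 2) \<or>
                      form_sum = - (of_nat (p - 1) * of_nat p ^ r * of_nat p ^ ((m - r) div 2))"
    using form_sum_values by blast
  have "card (radical UNIV) \<le> card {x. lin_poly u c x = 0}" using radical_trace_form_subset by (simp add: card_mono)
  hence "p ^ r \<le> p ^ 2" using card_lin_poly_roots[OF assms, of u] r(2) by linarith
  hence "r \<le> 2" by (rule power_le_imp_le_exp[OF p_gt1])
  show ?thesis
  proof (cases "even (m - r)")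
    case False thus ?thesis using r(3) T_eq_form_sum by simp
  next
    case True
    hence "r = 1" using odd_m r(1) \<open>r \<le> 2\<close> by presburger
    moreover have "(m + 1) div 2 = Suc ((m - 1) div 2)" using odd_m by presburger
    ultimately have "of_nat (p - 1) * of_nat p ^ r * of_nat p ^ ((m - r) div 2) = complex_of_real H"
      unfolding H_def using p_gt1 by (simp add: of_nat_diff)
    thus ?thesis using r(4) True T_eq_form_sum by auto
  qed
qed

text \<open>The relation forces \<open>x' / x\<close> into \<open>Fp\<close>, where the Frobenius acts trivially.\<close>
lemma quadratic_relation_frobenius:
  assumes y: "y \<in> Fp_units" and y': "y' \<in> Fp_units" and D: "y * x ^ 2 + y' * x' ^ 2 = 0"
  shows "y * x ^ (p ^ k + 1) + y' * x' ^ (p ^ k + 1) = 0"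
proof (cases "x = 0")
  case True
  hence "y' * x' ^ 2 = 0" using D by simp
  hence "x' = 0" using Fp_units_neq_0[OF y'] by simp
  thus ?thesis using True by simp
next
  case False
  define \<tau> where "\<tau> = x' / x"
  have y0: "y' \<noteq> 0" using Fp_units_neq_0[OF y'] .
  have yx: "y' * x' ^ 2 = - (y * x ^ 2)" using D by (simp add: eq_neg_iff_add_eq_0 add.commute)
  have t2: "\<tau> ^ 2 = - y / y'" unfolding \<tau>_def using False y0 yx
    by (simp add: power_divide field_simps)
  have "\<tau> ^ 2 \<in> Fp" unfolding t2 using Fp_units_in_Fp[OF y] Fp_units_in_Fp[OF y'] by (simp add: Fp_divide Fp_uminus)
  hence tP: "\<tau> \<in> Fp" by (rule Fp_if_square_in_Fp[OF odd_m])
  have x': "x' = \<tau> * x" unfolding \<tau>_def using False by simp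
  have "x' ^ (p ^ k + 1) = \<tau> ^ 2 * x ^ (p ^ k + 1)"
    unfolding x' power_frobenius_plus_1 using Fp_power_p_power[OF tP, of k] by (simp add: power_mult_distrib power2_eq_square mult_ac)
  hence "y * x ^ (p ^ k + 1) + y' * x' ^ (p ^ k + 1) = (y + y' * \<tau> ^ 2) * x ^ (p ^ k + 1)"
    by (simp add: algebra_simps)
  also have "y + y' * \<tau> ^ 2 = 0" unfolding t2 using y0 by simp
  finally show ?thesis by simp
qed

lemma sum_psi_trace_form_pair:
  assumes y: "y \<in> Fp_units" and y': "y' \<in> Fp_units"
  shows "(\<Sum>u\<in>UNIV. psi (y * trace_form u c x) * psi (y' * trace_form u c x')) =
    of_nat (p ^ m) * (if y * x ^ 2 + y' * x' ^ 2 = 0 then 1 else 0)"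
proof -
  have "(\<Sum>u\<in>UNIV. psi (y * trace_form u c x) * psi (y' * trace_form u c x')) =
     (\<Sum>u\<in>UNIV. psi (Tr ((y * x ^ 2 + y' * x' ^ 2) * u))) * psi (Tr (c * (y * x ^ (p ^ k + 1) + y' * x' ^ (p ^ k + 1))))"
    unfolding psi_trace_form_pair[OF Fp_units_in_Fp[OF y] Fp_units_in_Fp[OF y']] by (simp add: sum_distrib_right)
  thus ?thesis unfolding sum_psi_tr using quadratic_relation_frobenius[OF y y'] card_UNIV by auto
qed

lemma quotient_Fp_units_iff:
  assumes y: "y \<in> Fp_units" and x': "x' \<noteq> 0"
  shows "- (y * x ^ 2) / x' ^ 2 \<in> Fp_units \<longleftrightarrow> x / x' \<in> Fp_units"
proof
  assume t: "- (y * x ^ 2) / x' ^ 2 \<in> Fp_units"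
  have "(x / x') ^ 2 = - (- (y * x ^ 2) / x' ^ 2) / y" using Fp_units_neq_0[OF y] x'
    by (simp add: power_divide field_simps)
  moreover have "- (- (y * x ^ 2) / x' ^ 2) / y \<in> Fp"
    by (rule Fp_divide[OF Fp_uminus[OF Fp_units_in_Fp[OF t]] Fp_units_in_Fp[OF y]])
  ultimately have sq: "(x / x') ^ 2 \<in> Fp" by simp
  have "- (y * x ^ 2) / x' ^ 2 \<noteq> 0" using Fp_units_neq_0[OF t] .
  hence "x \<noteq> 0" by auto
  hence "x / x' \<noteq> 0" using x' by simp
  thus "x / x' \<in> Fp_units" using Fp_if_square_in_Fp[OF odd_m sq] unfolding Fp_units_def by simp
next
  assume t: "x / x' \<in> Fp_units"
  have "- (y * x ^ 2) / x' ^ 2 = (- y) * (x / x') ^ 2" by (simp add: power_divide)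
  moreover have "(- y) * (x / x') ^ 2 \<in> Fp" using Fp_units_in_Fp[OF t] Fp_units_in_Fp[OF y] by (simp add: Fp_mult Fp_power Fp_uminus)
  moreover have "(- y) * (x / x') ^ 2 \<noteq> 0" using Fp_units_neq_0[OF t] Fp_units_neq_0[OF y] by simp
  ultimately show "- (y * x ^ 2) / x' ^ 2 \<in> Fp_units" unfolding Fp_units_def by simp
qed

lemma count_unit_pairs:
  "(\<Sum>y\<in>Fp_units. \<Sum>y'\<in>Fp_units. if y * x ^ 2 + y' * x' ^ 2 = 0 then 1 else 0) =
   (if x' = 0 then (if x = 0 then of_nat ((p - 1) * (p - 1)) else 0)
    else if x / x' \<in> Fp_units then of_nat (p - 1) else (0::complex))"
proof (cases "x' = 0")
  case True
  thus ?thesis using card_Fp_units Fp_units_neq_0 by (cases "x = 0") simp_all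
next
  case False
  have "(\<Sum>y'\<in>Fp_units. if y * x ^ 2 + y' * x' ^ 2 = 0 then 1 else (0::complex)) =
      (if x / x' \<in> Fp_units then 1 else 0)" if y: "y \<in> Fp_units" for y
  proof -
    have "y * x ^ 2 + y' * x' ^ 2 = 0 \<longleftrightarrow> y' = - (y * x ^ 2) / x' ^ 2" for y'
      using False by (auto simp: field_simps eq_neg_iff_add_eq_0)
    thus ?thesis using quotient_Fp_units_iff[OF y False] by (simp add: sum.delta)
  qed
  thus ?thesis using False card_Fp_units by simp
qed

lemma card_Fp_units_multiples: assumes x': "x' \<noteq> (0::'a)" shows "card {x. x / x' \<in> Fp_units} = p - 1"
proof -
  have "{x. x / x' \<in> Fp_units} = (\<lambda>s. s * x') ` Fp_units"
  proof (intro set_eqI iffI)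
    fix x assume "x \<in> {x. x / x' \<in> Fp_units}"
    moreover have "x = (x / x') * x'" using x' by simp
    ultimately show "x \<in> (\<lambda>s. s * x') ` Fp_units" by blast
  qed (use x' in auto)
  moreover have "inj_on (\<lambda>s. s * x') Fp_units" using x' by (auto simp: inj_on_def)
  ultimately show ?thesis using card_Fp_units by (simp add: card_image)
qed

lemma count_diagonal_zeros:
  "(\<Sum>y\<in>Fp_units. \<Sum>y'\<in>Fp_units. \<Sum>x\<in>UNIV. \<Sum>x'\<in>UNIV. if y * x ^ 2 + y' * x' ^ 2 = 0 then 1 else 0) =
   (of_nat ((p - 1) * (p - 1) * p ^ m) :: complex)"
proof -
  define N :: "'a \<Rightarrow> 'a \<Rightarrow> complex" where
    "N x x' = (\<Sum>y\<in>Fp_units. \<Sum>y'\<in>Fp_units. if y * x ^ 2 + y' * x' ^ 2 = 0 then 1 else 0)" for x x'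
  have "(\<Sum>y\<in>Fp_units. \<Sum>y'\<in>Fp_units. \<Sum>x\<in>UNIV. \<Sum>x'\<in>UNIV. if y * x ^ 2 + y' * x' ^ 2 = 0 then 1 else 0) =
      (\<Sum>x'\<in>UNIV. \<Sum>x\<in>UNIV. N x x')"
    unfolding N_def by (subst sum_swap_pairs) (rule sum.swap)
  also have "\<dots> = (\<Sum>x\<in>UNIV. N x 0) + (\<Sum>x'\<in>UNIV - {0}. \<Sum>x\<in>UNIV. N x x')"
    by (simp add: sum.remove[of UNIV 0])
  also have "(\<Sum>x\<in>UNIV. N x 0) = of_nat ((p - 1) * (p - 1))"
    unfolding N_def count_unit_pairs by simp
  also have "(\<Sum>x'\<in>UNIV - {0}. \<Sum>x\<in>UNIV. N x x') = (\<Sum>x'\<in>UNIV - {0::'a}. of_nat ((p - 1) * (p - 1)))"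
    unfolding N_def count_unit_pairs
    by (intro sum.cong refl) (simp add: sum.If_cases card_Fp_units_multiples)
  also have "\<dots> = of_nat ((p ^ m - 1) * ((p - 1) * (p - 1)))"
    using card_UNIV by (simp add: card_Diff_singleton)
  also have "of_nat ((p - 1) * (p - 1)) + \<dots> = (of_nat ((p - 1) * (p - 1) * p ^ m) :: complex)"
  proof -
    obtain r where "p ^ m = Suc r" using p_gt1 by (metis gr0_implies_Suc zero_less_power gr_implies_not0 neq0_conv)
    hence "(p - 1) * (p - 1) + (p ^ m - 1) * ((p - 1) * (p - 1)) = (p - 1) * (p - 1) * p ^ m" by simp
    thus ?thesis by (metis of_nat_add)
  qed
  finally show ?thesis .
qed

lemma sum_T_squared: "(\<Sum>u\<in>UNIV. T u c * T u c) = (of_nat ((p - 1) * (p - 1) * p ^ m * p ^ m) :: complex)"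
proof -
  have "(\<Sum>u\<in>UNIV. T u c * T u c) = (\<Sum>y\<in>Fp_units. \<Sum>y'\<in>Fp_units. \<Sum>x\<in>UNIV. \<Sum>x'\<in>UNIV. \<Sum>u\<in>UNIV.
          psi (y * trace_form u c x) * psi (y' * trace_form u c x'))"
  proof -
    have "(\<Sum>u\<in>UNIV. T u c * T u c) = (\<Sum>u\<in>UNIV. \<Sum>y\<in>Fp_units. \<Sum>y'\<in>Fp_units. \<Sum>x\<in>UNIV. \<Sum>x'\<in>UNIV.
          psi (y * trace_form u c x) * psi (y' * trace_form u c x'))"
      unfolding T_def by (simp add: sum_product)
    also have "\<dots> = (\<Sum>y\<in>Fp_units. \<Sum>y'\<in>Fp_units. \<Sum>u\<in>UNIV. \<Sum>x\<in>UNIV. \<Sum>x'\<in>UNIV.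
          psi (y * trace_form u c x) * psi (y' * trace_form u c x'))" by (rule sum_swap_innermost)
    also have "\<dots> = (\<Sum>y\<in>Fp_units. \<Sum>y'\<in>Fp_units. \<Sum>x\<in>UNIV. \<Sum>x'\<in>UNIV. \<Sum>u\<in>UNIV.
          psi (y * trace_form u c x) * psi (y' * trace_form u c x'))" by (intro sum.cong refl sum_swap_innermost)
    finally show ?thesis .
  qed
  also have "\<dots> = of_nat (p ^ m) * (\<Sum>y\<in>Fp_units. \<Sum>y'\<in>Fp_units. \<Sum>x\<in>UNIV. \<Sum>x'\<in>UNIV.
       if y * x ^ 2 + y' * x' ^ 2 = 0 then 1 else 0)"
    by (simp add: sum_psi_trace_form_pair sum_distrib_left)
  finally show ?thesis unfolding count_diagonal_zeros by simp
qed

definition K :: real where "K = (real p - 1) * real p ^ m"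

definition q :: real where "q = real p ^ ((m - 1) div 2)"

lemma power_p_eq_q:
  "real p ^ m = real p * q ^ 2" "real p ^ (m - 1) = q ^ 2" "real p ^ ((m + 1) div 2) = real p * q"
  "real p ^ (2 * m) = real p ^ 2 * q ^ 4" "real p ^ (2 * (m - 1)) = q ^ 4" "real p ^ (2 * m - 1) = real p * q ^ 4"
proof -
  obtain j where j: "m = 2 * j + 1" using odd_m oddE by blast
  have jj: "(m - 1) div 2 = j" "(m + 1) div 2 = Suc j" "m - 1 = 2 * j" "2 * m - 1 = Suc (4 * j)" "2 * (m - 1) = 4 * j"
    "2 * m = 4 * j + 2" using j by auto
  have s: "q = real p ^ j" unfolding q_def jj(1) ..
  have pw: "\<And>a. (real p ^ j) ^ a = real p ^ (j * a)" by (simp add: power_mult)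
  show "real p ^ m = real p * q ^ 2" unfolding s pw by (simp add: j power_add mult.commute)
  show "real p ^ (m - 1) = q ^ 2" unfolding s pw jj by (simp add: mult.commute)
  show "real p ^ ((m + 1) div 2) = real p * q" unfolding s jj by simp
  show "real p ^ (2 * m) = real p ^ 2 * q ^ 4" unfolding s pw jj by (simp add: power_add mult.commute power2_eq_square)
  show "real p ^ (2 * (m - 1)) = q ^ 4" unfolding s pw jj by (simp add: mult.commute)
  show "real p ^ (2 * m - 1) = real p * q ^ 4" unfolding s pw jj by (simp add: mult.commute)
qed

lemma q_ge_3: "q \<ge> 3"
proof -
  have "(m - 1) div 2 \<ge> 1" using m_ge_3 odd_m by presburger
  hence "real p ^ 1 \<le> q" unfolding q_def by (rule power_increasing) (use p_gt1 in simp)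
  thus ?thesis using p_ge3 by simp
qed

lemma H_pos: "H > 0" unfolding H_def using p_gt1 by simp

lemma K_eq_q_H: "K = q * H"
  unfolding K_def H_def power_p_eq_q by (simp add: algebra_simps power2_eq_square)

definition T_re :: "'a \<Rightarrow> 'a \<Rightarrow> real" where "T_re u c = Re (T u c)"

lemma T_real: "T u c = complex_of_real (T_re u c)"
proof -
  have "T u c \<in> \<real>"
  proof (cases "c = 0")
    case True
    thus ?thesis using T_0_0 T_u_0 by (cases "u = 0") simp_all
  next
    case False
    thus ?thesis using T_values[OF False, of u] by auto
  qed
  thus ?thesis unfolding T_re_def by (simp add: Reals_def)
qed

lemma T_re_0_0: "T_re 0 0 = K"
  unfolding T_re_def K_def using T_0_0 p_gt1 by (simp add: of_nat_diff)

lemma T_re_u_0: "u \<noteq> 0 \<Longrightarrow> T_re u 0 = 0"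
  unfolding T_re_def using T_u_0 by simp

lemma T_re_values: "c \<noteq> 0 \<Longrightarrow> T_re u c \<in> {0, H, - H}"
  using T_values[of c u] unfolding T_re_def by auto

lemma sum_T_re: "(\<Sum>u\<in>UNIV. T_re u c) = (real p - 1) * real p ^ m"
proof -
  have "complex_of_real (\<Sum>u\<in>UNIV. T_re u c) = (\<Sum>u\<in>UNIV. T u c)" by (simp add: T_real)
  also have "\<dots> = complex_of_real ((real p - 1) * real p ^ m)" unfolding sum_T using p_gt1 by (simp add: of_nat_diff)
  finally show ?thesis by (simp only: of_real_eq_iff)
qed

lemma sum_T_re_squared: "(\<Sum>u\<in>UNIV. T_re u c ^ 2) = ((real p - 1) * real p ^ m) ^ 2"
proof -
  have "complex_of_real (\<Sum>u\<in>UNIV. T_re u c ^ 2) = (\<Sum>u\<in>UNIV. T u c * T u c)" by (simp add: T_real power2_eq_square)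
  also have "\<dots> = complex_of_real (((real p - 1) * real p ^ m) ^ 2)" unfolding sum_T_squared using p_gt1
    by (simp add: of_nat_diff power2_eq_square power_mult_distrib mult_ac)
  finally show ?thesis by (simp only: of_real_eq_iff)
qed

definition N_plus :: "'a \<Rightarrow> real" where "N_plus c = real (card {u. T_re u c = H})"
definition N_minus :: "'a \<Rightarrow> real" where "N_minus c = real (card {u. T_re u c = - H})"
definition N_zero :: "'a \<Rightarrow> real" where "N_zero c = real (card {u. T_re u c = 0})"

lemma sum_by_T_re_value: assumes "c \<noteq> 0"
  shows "(\<Sum>u\<in>UNIV. g (T_re u c)) = g 0 * N_zero c + g H * N_plus c + g (- H) * N_minus c"
proof -
  have "(\<Sum>u\<in>UNIV. g (T_re u c)) = (\<Sum>t\<in>{0, H, - H}. g t * real (card {u. T_re u c = t}))"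
    by (rule sum_by_value) (use T_re_values[OF assms] in auto)
  also have "\<dots> = g 0 * N_zero c + g H * N_plus c + g (- H) * N_minus c"
    using H_pos unfolding N_zero_def N_plus_def N_minus_def by simp
  finally show ?thesis .
qed

lemma sum_by_T_re_value_0: "(\<Sum>u\<in>UNIV. g (T_re u 0)) = g K + g 0 * (real p ^ m - 1)"
proof -
  have "(\<Sum>u\<in>UNIV. g (T_re u 0)) = g (T_re 0 0) + (\<Sum>u\<in>UNIV - {0}. g (T_re u 0))"
    by (simp add: sum.remove[of UNIV 0])
  also have "(\<Sum>u\<in>UNIV - {0}. g (T_re u 0)) = (\<Sum>u\<in>UNIV - {0::'a}. g 0)"
    using T_re_u_0 by (intro sum.cong) auto
  finally show ?thesis
    using T_re_0_0 card_UNIV p_gt1 by (simp add: card_Diff_singleton of_nat_diff mult.commute)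
qed

lemma value_counts: assumes "c \<noteq> 0"
  shows "N_plus c = (q ^ 2 + q) / 2" "N_minus c = (q ^ 2 - q) / 2" "N_zero c = real p * q ^ 2 - q ^ 2"
proof -
  have HHs: "H = (real p - 1) * real p * q" unfolding H_def power_p_eq_q by simp
  have nz: "(real p - 1) * real p * q \<noteq> 0" using q_ge_3 p_gt1 by simp
  have "H * N_plus c - H * N_minus c = (real p - 1) * (real p * q ^ 2)"
    using sum_T_re[of c] sum_by_T_re_value[OF assms, of "\<lambda>t. t"] power_p_eq_q by simp
  hence "((real p - 1) * real p * q) * (N_plus c - N_minus c) = ((real p - 1) * real p * q) * q"
    unfolding HHs by (simp add: algebra_simps power2_eq_square)
  hence d: "N_plus c - N_minus c = q" using nz by simp
  have "H ^ 2 * N_plus c + H ^ 2 * N_minus c = ((real p - 1) * (real p * q ^ 2)) ^ 2"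
    using sum_T_re_squared[of c] sum_by_T_re_value[OF assms, of "\<lambda>t. t ^ 2"] power_p_eq_q by simp
  hence "((real p - 1) * real p * q) ^ 2 * (N_plus c + N_minus c) = ((real p - 1) * real p * q) ^ 2 * q ^ 2"
    unfolding HHs by (simp add: algebra_simps power2_eq_square)
  hence a: "N_plus c + N_minus c = q ^ 2" using nz by simp
  have "N_zero c + N_plus c + N_minus c = real p * q ^ 2"
    using sum_by_T_re_value[OF assms, of "\<lambda>t. 1"] card_UNIV power_p_eq_q by simp
  thus "N_plus c = (q ^ 2 + q) / 2" "N_minus c = (q ^ 2 - q) / 2" "N_zero c = real p * q ^ 2 - q ^ 2"
    using a d by simp_all
qed

subsection \<open>Counting the values of \<open>S\<close>\<close>

definition pair_count :: "'a \<Rightarrow> real \<Rightarrow> real" where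
  "pair_count c v = (\<Sum>u\<in>UNIV. \<Sum>w\<in>UNIV. of_bool (T_re u c + T_re w c = v))"

lemma card_S_eq_sum_pair_count: assumes lam: "lam \<in> Fp_units"
  shows "real (card {(a, b, c). S p m k lam a b c = complex_of_real v}) = (\<Sum>c\<in>UNIV. pair_count c v)"
proof -
  have "real (card {(a, b, c). S p m k lam a b c = complex_of_real v}) =
      (\<Sum>a\<in>UNIV. \<Sum>b\<in>UNIV. \<Sum>c\<in>UNIV. of_bool (T_re (a + b) c + T_re (a - b) c = v))"
    unfolding real_card_eq_sum_of_bool sum_UNIV_triple S_eq_T_sum[OF lam] T_real by (simp flip: of_real_add)
  also have "\<dots> = (\<Sum>u\<in>UNIV. \<Sum>w\<in>UNIV. \<Sum>c\<in>UNIV. of_bool (T_re u c + T_re w c = v))"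
    by (rule sum_plus_minus_reindex[OF two_neq_zero, where f = "\<lambda>u w. \<Sum>c\<in>UNIV. of_bool (T_re u c + T_re w c = v)"])
  also have "\<dots> = (\<Sum>c\<in>UNIV. pair_count c v)"
    unfolding pair_count_def by (rule sum_swap_innermost[symmetric])
  finally show ?thesis .
qed

lemma pair_count_c: assumes c: "c \<noteq> 0"
  shows "pair_count c v =
    of_bool (0 + 0 = v) * N_zero c * N_zero c + of_bool (0 + H = v) * N_zero c * N_plus c
    + of_bool (0 + - H = v) * N_zero c * N_minus c + of_bool (H + 0 = v) * N_plus c * N_zero c
    + of_bool (H + H = v) * N_plus c * N_plus c + of_bool (H + - H = v) * N_plus c * N_minus c
    + of_bool (- H + 0 = v) * N_minus c * N_zero c + of_bool (- H + H = v) * N_minus c * N_plus c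
    + of_bool (- H + - H = v) * N_minus c * N_minus c"
proof -
  have "pair_count c v = (\<Sum>u\<in>UNIV. of_bool (T_re u c + 0 = v) * N_zero c + of_bool (T_re u c + H = v) * N_plus c
      + of_bool (T_re u c + - H = v) * N_minus c)"
    unfolding pair_count_def by (rule sum.cong[OF refl], rule sum_by_T_re_value[OF c])
  also have "\<dots> = (of_bool (0 + 0 = v) * N_zero c + of_bool (0 + H = v) * N_plus c + of_bool (0 + - H = v) * N_minus c) * N_zero c
      + (of_bool (H + 0 = v) * N_zero c + of_bool (H + H = v) * N_plus c + of_bool (H + - H = v) * N_minus c) * N_plus c
      + (of_bool (- H + 0 = v) * N_zero c + of_bool (- H + H = v) * N_plus c + of_bool (- H + - H = v) * N_minus c) * N_minus c"
    by (rule sum_by_T_re_value[OF c])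
  finally show ?thesis by (simp only: algebra_simps)
qed

lemma pair_count_0:
  "pair_count 0 v = of_bool (K + K = v) + 2 * of_bool (K = v) * (real p ^ m - 1) + of_bool (0 = v) * (real p ^ m - 1) ^ 2"
proof -
  have "pair_count 0 v = (\<Sum>u\<in>UNIV. of_bool (T_re u 0 + K = v) + of_bool (T_re u 0 + 0 = v) * (real p ^ m - 1))"
    unfolding pair_count_def by (rule sum.cong[OF refl], rule sum_by_T_re_value_0)
  also have "\<dots> = (of_bool (K + K = v) + of_bool (K + 0 = v) * (real p ^ m - 1))
      + (of_bool (0 + K = v) + of_bool (0 + 0 = v) * (real p ^ m - 1)) * (real p ^ m - 1)"
    by (rule sum_by_T_re_value_0)
  finally show ?thesis by (simp add: algebra_simps power2_eq_square)
qed

text \<open>The frequencies for \<open>c \<noteq> 0\<close> do not depend on \<open>c\<close>.\<close>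
lemma card_S: assumes lam: "lam \<in> Fp_units"
  shows "real (card {(a, b, c). S p m k lam a b c = complex_of_real v}) = pair_count 0 v + (real p ^ m - 1) * pair_count 1 v"
proof -
  have pair_count_c_1: "pair_count c v = pair_count 1 v" if "c \<noteq> 0" for c
    unfolding pair_count_c[OF that] pair_count_c[OF one_neq_zero] value_counts[OF that] value_counts[OF one_neq_zero] ..
  have "(\<Sum>c\<in>UNIV. pair_count c v) = pair_count 0 v + (\<Sum>c\<in>UNIV - {0}. pair_count c v)" by (simp add: sum.remove[of UNIV 0])
  also have "(\<Sum>c\<in>UNIV - {0}. pair_count c v) = (\<Sum>c\<in>UNIV - {0::'a}. pair_count 1 v)"
    by (rule sum.cong[OF refl], rule pair_count_c_1) simp
  also have "\<dots> = (real p ^ m - 1) * pair_count 1 v" using card_UNIV p_gt1 by (simp add: card_Diff_singleton of_nat_diff)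
  finally show ?thesis using card_S_eq_sum_pair_count[OF lam] by simp
qed

text \<open>This keeps the seven values \<open>2K, K, \<plusminus>H, \<plusminus>2H, 0\<close> apart; it is where \<open>m \<ge> 3\<close> is used.\<close>
lemma K_ge_3H: "K \<ge> 3 * H"
  unfolding K_eq_q_H using q_ge_3 H_pos by (simp add: mult_right_mono)

lemma pair_count_1_values:
  "pair_count 1 (K + K) = 0" "pair_count 1 K = 0"
  "pair_count 1 H = 2 * N_zero 1 * N_plus 1" "pair_count 1 (- H) = 2 * N_zero 1 * N_minus 1"
  "pair_count 1 (2 * H) = N_plus 1 * N_plus 1" "pair_count 1 (- 2 * H) = N_minus 1 * N_minus 1"
  "pair_count 1 0 = N_zero 1 * N_zero 1 + 2 * N_plus 1 * N_minus 1"
  using H_pos K_ge_3H unfolding pair_count_c[OF one_neq_zero] of_bool_def by (auto simp: algebra_simps)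

lemma pair_count_0_values:
  "pair_count 0 (K + K) = 1" "pair_count 0 K = 2 * (real p ^ m - 1)"
  "pair_count 0 H = 0" "pair_count 0 (- H) = 0" "pair_count 0 (2 * H) = 0" "pair_count 0 (- 2 * H) = 0"
  "pair_count 0 0 = (real p ^ m - 1) ^ 2"
  using H_pos K_ge_3H unfolding pair_count_0 of_bool_def by auto

lemma S_values:
  assumes "lam \<in> Fp_units"
  shows "S p m k lam a b c \<in> complex_of_real ` {
        2 * (real p - 1) * real p ^ m,
        (real p - 1) * real p ^ m,
        (real p - 1) * real p ^ ((m + 1) div 2),
        - (real p - 1) * real p ^ ((m + 1) div 2),
        2 * (real p - 1) * real p ^ ((m + 1) div 2),
        - 2 * (real p - 1) * real p ^ ((m + 1) div 2),
        0}"
proof -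
  have "T_re (a + b) c + T_re (a - b) c \<in> {K + K, K, H, - H, 2 * H, - 2 * H, 0}"
  proof (cases "c = 0")
    case True
    have "T_re u 0 = K \<or> T_re u 0 = 0" for u using T_re_0_0 T_re_u_0 by (cases "u = 0") auto
    from this[of "a + b"] this[of "a - b"] show ?thesis using True by auto
  next
    case False
    thus ?thesis using T_re_values[OF False, of "a + b"] T_re_values[OF False, of "a - b"] by auto
  qed
  moreover have "S p m k lam a b c = complex_of_real (T_re (a + b) c + T_re (a - b) c)"
    unfolding S_eq_T_sum[OF assms] T_real by simp
  moreover have "{2 * (real p - 1) * real p ^ m, (real p - 1) * real p ^ m,
        (real p - 1) * real p ^ ((m + 1) div 2), - (real p - 1) * real p ^ ((m + 1) div 2),
        2 * (real p - 1) * real p ^ ((m + 1) div 2), - 2 * (real p - 1) * real p ^ ((m + 1) div 2), 0}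
      = {K + K, K, H, - H, 2 * H, - 2 * H, 0}"
    unfolding K_def H_def by (simp add: algebra_simps)
  ultimately show ?thesis by (simp only:) (rule imageI)
qed

lemma card_S_values:
  assumes lam: "lam \<in> Fp_units"
  shows "real (card {(a, b, c). S p m k lam a b c = complex_of_real (2 * (real p - 1) * real p ^ m)}) = 1"
    and "real (card {(a, b, c). S p m k lam a b c = complex_of_real ((real p - 1) * real p ^ m)})
       = 2 * (real p ^ m - 1)"
    and "real (card {(a, b, c). S p m k lam a b c = complex_of_real ((real p - 1) * real p ^ ((m + 1) div 2))})
       = (real p ^ m - 1) * (real p ^ m - real p ^ (m - 1)) * (real p ^ (m - 1) + real p ^ ((m - 1) div 2))"
    and "real (card {(a, b, c). S p m k lam a b c = complex_of_real (- (real p - 1) * real p ^ ((m + 1) div 2))})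
       = (real p ^ m - 1) * (real p ^ m - real p ^ (m - 1)) * (real p ^ (m - 1) - real p ^ ((m - 1) div 2))"
    and "real (card {(a, b, c). S p m k lam a b c = complex_of_real (2 * (real p - 1) * real p ^ ((m + 1) div 2))})
       = 1 / 4 * (real p ^ m - 1) * (real p ^ (m - 1) + real p ^ ((m - 1) div 2)) ^ 2"
    and "real (card {(a, b, c). S p m k lam a b c = complex_of_real (- 2 * (real p - 1) * real p ^ ((m + 1) div 2))})
       = 1 / 4 * (real p ^ m - 1) * (real p ^ (m - 1) - real p ^ ((m - 1) div 2)) ^ 2"
    and "real (card {(a, b, c). S p m k lam a b c = 0})
       = (real p ^ m - 1) * (real p ^ (2 * m) + 3 / 2 * real p ^ (2 * (m - 1)) - 2 * real p ^ (2 * m - 1)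
           + real p ^ m - 1 / 2 * real p ^ (m - 1) - 1)"
proof -
  have K: "2 * (real p - 1) * real p ^ m = K + K" "(real p - 1) * real p ^ m = K" unfolding K_def by simp_all
  have H: "(real p - 1) * real p ^ ((m + 1) div 2) = H" "- (real p - 1) * real p ^ ((m + 1) div 2) = - H"
    "2 * (real p - 1) * real p ^ ((m + 1) div 2) = 2 * H" "- 2 * (real p - 1) * real p ^ ((m + 1) div 2) = - 2 * H"
    unfolding H_def by (simp_all add: algebra_simps)
  note count = card_S[OF lam] pair_count_1_values pair_count_0_values value_counts[OF one_neq_zero]
  note powers = q_def[symmetric] power_p_eq_q
  show "real (card {(a, b, c). S p m k lam a b c = complex_of_real (2 * (real p - 1) * real p ^ m)}) = 1"
    unfolding K count by simp
  show "real (card {(a, b, c). S p m k lam a b c = complex_of_real ((real p - 1) * real p ^ m)})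
       = 2 * (real p ^ m - 1)"
    unfolding K count by simp
  show "real (card {(a, b, c). S p m k lam a b c = complex_of_real ((real p - 1) * real p ^ ((m + 1) div 2))})
       = (real p ^ m - 1) * (real p ^ m - real p ^ (m - 1)) * (real p ^ (m - 1) + real p ^ ((m - 1) div 2))"
    unfolding H count unfolding powers by (simp add: field_simps power2_eq_square)
  show "real (card {(a, b, c). S p m k lam a b c = complex_of_real (- (real p - 1) * real p ^ ((m + 1) div 2))})
       = (real p ^ m - 1) * (real p ^ m - real p ^ (m - 1)) * (real p ^ (m - 1) - real p ^ ((m - 1) div 2))"
    unfolding H count unfolding powers by (simp add: field_simps power2_eq_square)
  show "real (card {(a, b, c). S p m k lam a b c = complex_of_real (2 * (real p - 1) * real p ^ ((m + 1) div 2))})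
       = 1 / 4 * (real p ^ m - 1) * (real p ^ (m - 1) + real p ^ ((m - 1) div 2)) ^ 2"
    unfolding H count unfolding powers by (simp add: field_simps power2_eq_square)
  show "real (card {(a, b, c). S p m k lam a b c = complex_of_real (- 2 * (real p - 1) * real p ^ ((m + 1) div 2))})
       = 1 / 4 * (real p ^ m - 1) * (real p ^ (m - 1) - real p ^ ((m - 1) div 2)) ^ 2"
    unfolding H count unfolding powers by (simp add: field_simps power2_eq_square)
  show "real (card {(a, b, c). S p m k lam a b c = 0})
       = (real p ^ m - 1) * (real p ^ (2 * m) + 3 / 2 * real p ^ (2 * (m - 1)) - 2 * real p ^ (2 * m - 1)
           + real p ^ m - 1 / 2 * real p ^ (m - 1) - 1)"
    using card_S[OF lam, of 0] unfolding of_real_0 pair_count_1_values pair_count_0_values value_counts[OF one_neq_zero]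
    unfolding powers by (simp add: field_simps power2_eq_square power4_eq_xxxx)
qed

end

theorem theorem3p5:
  fixes p m k :: nat and lam :: "'a::{field,finite}"
  assumes "prime p" and "odd p"
    and "card (UNIV::'a set) = p ^ m" and "of_nat p = (0::'a)"
    and "odd m" and "m \<ge> 3" and "even k" and "k \<ge> 1" and "coprime m k"
    and "lam \<in> range of_nat" and "\<forall>z \<in> range (of_nat :: nat \<Rightarrow> 'a). z ^ 2 \<noteq> lam"
  shows
    "(\<forall>a b c. S p m k lam a b c \<in> complex_of_real ` {
        2 * (real p - 1) * real p ^ m,
        (real p - 1) * real p ^ m,
        (real p - 1) * real p ^ ((m + 1) div 2),
        - (real p - 1) * real p ^ ((m + 1) div 2),
        2 * (real p - 1) * real p ^ ((m + 1) div 2),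
        - 2 * (real p - 1) * real p ^ ((m + 1) div 2),
        0})
   \<and> real (card {(a, b, c). S p m k lam a b c = complex_of_real (2 * (real p - 1) * real p ^ m)}) = 1
   \<and> real (card {(a, b, c). S p m k lam a b c = complex_of_real ((real p - 1) * real p ^ m)})
       = 2 * (real p ^ m - 1)
   \<and> real (card {(a, b, c). S p m k lam a b c = complex_of_real ((real p - 1) * real p ^ ((m + 1) div 2))})
       = (real p ^ m - 1) * (real p ^ m - real p ^ (m - 1)) * (real p ^ (m - 1) + real p ^ ((m - 1) div 2))
   \<and> real (card {(a, b, c). S p m k lam a b c = complex_of_real (- (real p - 1) * real p ^ ((m + 1) div 2))})
       = (real p ^ m - 1) * (real p ^ m - real p ^ (m - 1)) * (real p ^ (m - 1) - real p ^ ((m - 1) div 2))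
   \<and> real (card {(a, b, c). S p m k lam a b c = complex_of_real (2 * (real p - 1) * real p ^ ((m + 1) div 2))})
       = 1 / 4 * (real p ^ m - 1) * (real p ^ (m - 1) + real p ^ ((m - 1) div 2)) ^ 2
   \<and> real (card {(a, b, c). S p m k lam a b c = complex_of_real (- 2 * (real p - 1) * real p ^ ((m + 1) div 2))})
       = 1 / 4 * (real p ^ m - 1) * (real p ^ (m - 1) - real p ^ ((m - 1) div 2)) ^ 2
   \<and> real (card {(a, b, c). S p m k lam a b c = 0})
       = (real p ^ m - 1) * (real p ^ (2 * m) + 3 / 2 * real p ^ (2 * (m - 1)) - 2 * real p ^ (2 * m - 1)
           + real p ^ m - 1 / 2 * real p ^ (m - 1) - 1)"
proof -
  interpret trace_form_setting p m "TYPE('a)" k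
    by unfold_locales (use assms in auto)
  have "lam \<in> Fp_units"
    using assms(10,11) unfolding Fp_units_def Fp_def by (metis Diff_iff empty_iff insert_iff power_zero_numeral rangeI of_nat_0)
  thus ?thesis using S_values card_S_values by blast
qed

end
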